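(* Let $M_n$ be the maximal distance of any vertex of the random friend tree $T_n$ to its nearest leaf in $T_n$. Then $$M_n=\Theta\left(\frac{\log n}{\log\log n}\right)\quad\text{in probability.}$$
   Context: The random friend tree process $(T_n)_{n\ge 2}$ is defined as follows. $T_2$ is a single edge joining vertices labelled $1$ and $2$. For $n\ge 2$, given $T_n$ (and the past of the process), $V_n$ is chosen uniformly at random in $\{1,\dots,n\}$, and then $W_n$ is a uniformly random neighbour of $V_n$ in $T_n$; $T_{n+1}$ is obtained from $T_n$ by adding a new vertex labelled $n+1$ joined by an edge to $W_n$. Thus $T_n$ is a tree with vertex set $[n]=\{1,\dots,n\}$. Write $D_n(v)$ for the degree of $v$ in $T_n$ and $d_n$ for the graph distance in $T_n$; a leaf is a vertex of degree one. Explicitly, $M_n=\max_{i\le n}\min_{\ell:\,D_n(\ell)=1}d_n(i,\ell)$. For sequences $(X_n),(Y_n)$ of non-negative random variables: $X_n=O_p(Y_n)$, equivalently $Y_n=\Omega_p(X_n)$, means that for all $\varepsilon>0$ there exist $N>0$ and $K>0$ such that $\mathbf{P}\{X_n>KY_n\}<\varepsilon$ for all $n\ge N$. "$X_n=\Theta(Y_n)$ in probability" means that both $X_n=O_p(Y_n)$ and $X_n=\Omega_p(Y_n)$ hold. (Only large $n$, for which $\log\log n>0$, matter.) *)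

theory Defs
  imports "HOL-Probability.Probability"
begin

text \<open>A graph is given by its set of edges, each edge being a two-element set of vertex labels.\<close>

definition nbrs :: "nat set set \<Rightarrow> nat \<Rightarrow> nat set" where
  "nbrs E v = {u. {v, u} \<in> E}"

definition vertex_degree :: "nat set set \<Rightarrow> nat \<Rightarrow> nat" where
  "vertex_degree E v = card (nbrs E v)"

text \<open>\<open>R ^^ k\<close> relates the endpoints of walks with \<open>k\<close> edges. If no walk joins \<open>u\<close> and \<open>v\<close>,
  the value is meaningless; this does not occur in a tree.\<close>

definition graph_dist :: "nat set set \<Rightarrow> nat \<Rightarrow> nat \<Rightarrow> nat" where
  "graph_dist E u v = (LEAST k. (u, v) \<in> {(a, b). {a, b} \<in> E} ^^ k)"

definition leaves :: "nat \<Rightarrow> nat set set \<Rightarrow> nat set" where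
  "leaves n E = {l \<in> {1..n}. vertex_degree E l = 1}"

definition max_leaf_dist :: "nat \<Rightarrow> nat set set \<Rightarrow> nat" where
  "max_leaf_dist n E = (MAX i\<in>{1..n}. MIN l\<in>leaves n E. graph_dist E i l)"

text \<open>The event that \<open>T\<^sub>n\<close> is \<open>E\<close> and that the earlier choices \<open>V\<^sub>k\<close>, \<open>W\<^sub>k\<close> (\<open>2 \<le> k < n\<close>)
  have the prescribed values \<open>vs k\<close>, \<open>ws k\<close>.\<close>

definition past ::
  "(nat \<Rightarrow> 'a \<Rightarrow> nat) \<Rightarrow> (nat \<Rightarrow> 'a \<Rightarrow> nat) \<Rightarrow> (nat \<Rightarrow> 'a \<Rightarrow> nat set set) \<Rightarrow>
   nat \<Rightarrow> nat set set \<Rightarrow> (nat \<Rightarrow> nat) \<Rightarrow> (nat \<Rightarrow> nat) \<Rightarrow> 'a \<Rightarrow> bool" where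
  "past V W T n E vs ws \<omega> \<longleftrightarrow>
     T n \<omega> = E \<and> (\<forall>k\<in>{2..<n}. V k \<omega> = vs k \<and> W k \<omega> = ws k)"

text \<open>Since the choices are discrete, conditioning on the past amounts to conditioning on each
  of its atoms of positive probability.\<close>

locale random_friend_tree = prob_space M
  for M :: "'a measure" +
  fixes V W :: "nat \<Rightarrow> 'a \<Rightarrow> nat" and T :: "nat \<Rightarrow> 'a \<Rightarrow> nat set set"
  assumes V_measurable: "n \<ge> 2 \<Longrightarrow> V n \<in> measurable M (count_space UNIV)"
    and W_measurable: "n \<ge> 2 \<Longrightarrow> W n \<in> measurable M (count_space UNIV)"
    and T_2: "\<omega> \<in> space M \<Longrightarrow> T 2 \<omega> = {{1, 2}}"
    and T_Suc: "n \<ge> 2 \<Longrightarrow> \<omega> \<in> space M \<Longrightarrow> T (Suc n) \<omega> = insert {W n \<omega>, Suc n} (T n \<omega>)"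
    and V_uniform:
      "n \<ge> 2 \<Longrightarrow> \<P>(\<omega> in M. past V W T n E vs ws \<omega>) > 0 \<Longrightarrow> v \<in> {1..n} \<Longrightarrow>
       \<P>(\<omega> in M. V n \<omega> = v \<bar> past V W T n E vs ws \<omega>) = 1 / real n"
    and W_uniform:
      "n \<ge> 2 \<Longrightarrow> \<P>(\<omega> in M. past V W T n E vs ws \<omega> \<and> V n \<omega> = v) > 0 \<Longrightarrow> w \<in> nbrs E v \<Longrightarrow>
       \<P>(\<omega> in M. W n \<omega> = w \<bar> past V W T n E vs ws \<omega> \<and> V n \<omega> = v) = 1 / real (vertex_degree E v)"

definition O_p :: "'a measure \<Rightarrow> (nat \<Rightarrow> 'a \<Rightarrow> real) \<Rightarrow> (nat \<Rightarrow> 'a \<Rightarrow> real) \<Rightarrow> bool" where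
  "O_p M X Y \<longleftrightarrow>
     (\<forall>\<epsilon>>0. \<exists>N>0. \<exists>K>0. \<forall>n\<ge>N. \<P>(\<omega> in M. X n \<omega> > K * Y n \<omega>) < \<epsilon>)"

definition Omega_p :: "'a measure \<Rightarrow> (nat \<Rightarrow> 'a \<Rightarrow> real) \<Rightarrow> (nat \<Rightarrow> 'a \<Rightarrow> real) \<Rightarrow> bool" where
  "Omega_p M X Y \<longleftrightarrow> O_p M Y X"

definition Theta_p :: "'a measure \<Rightarrow> (nat \<Rightarrow> 'a \<Rightarrow> real) \<Rightarrow> (nat \<Rightarrow> 'a \<Rightarrow> real) \<Rightarrow> bool" where
  "Theta_p M X Y \<longleftrightarrow> O_p M X Y \<and> Omega_p M X Y"

text \<open>The process exists: take independent draws, one for each step \<open>n\<close> (index \<open>(n, None)\<close>,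
  uniform on \<open>{1..n}\<close>) and one for each step and each possible neighbourhood, listed in increasing
  order (index \<open>(n, Some l)\<close>, uniform on \<open>set l\<close>).\<close>

lemma finite_nbrs: "finite E \<Longrightarrow> finite (nbrs E v)"
proof -
  assume "finite E"
  have "inj_on (\<lambda>u. {v, u}) (nbrs E v)"
    by (auto simp: inj_on_def doubleton_eq_iff)
  moreover have "(\<lambda>u. {v, u}) ` nbrs E v \<subseteq> E"
    by (auto simp: nbrs_def)
  ultimately show ?thesis
    using \<open>finite E\<close> by (meson finite_subset finite_imageD)
qed

type_synonym draw = "nat \<times> nat list option"

definition draw_pmf :: "draw \<Rightarrow> nat pmf" where
  "draw_pmf i = (case i of (n, None) \<Rightarrow> pmf_of_set {1..n} | (n, Some l) \<Rightarrow> pmf_of_set (set l))"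

definition draw_nbr :: "(draw \<Rightarrow> nat) \<Rightarrow> nat \<Rightarrow> nat set set \<Rightarrow> nat" where
  "draw_nbr \<omega> n E = \<omega> (n, Some (sorted_list_of_set (nbrs E (\<omega> (n, None)))))"

fun draw_tree :: "nat \<Rightarrow> (draw \<Rightarrow> nat) \<Rightarrow> nat set set" where
  "draw_tree 0 \<omega> = {{1, 2}}"
| "draw_tree (Suc n) \<omega> =
    (if n < 2 then {{1, 2}} else insert {draw_nbr \<omega> n (draw_tree n \<omega>), Suc n} (draw_tree n \<omega>))"

lemma draw_tree_cong:
  "(\<And>k l. k < n \<Longrightarrow> \<omega> (k, l) = \<omega>' (k, l)) \<Longrightarrow> draw_tree n \<omega> = draw_tree n \<omega>'"
  by (induction n) (auto simp: draw_nbr_def)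

lemma finite_draw_tree: "finite (draw_tree n \<omega>)"
  by (induction n) auto

definition draw_graphs :: "nat set set set" where "draw_graphs = {E. finite E \<and> E \<subseteq> Collect finite}"

lemma countable_draw_graphs: "countable draw_graphs"
  unfolding draw_graphs_def by (rule countable_Collect_finite_subset[OF countable_Collect_finite])

lemma draw_coord_meas:
  assumes "i \<in> J"
  shows "(\<lambda>\<omega>. \<omega> i) \<in> measurable (PiM J (\<lambda>i. measure_pmf (draw_pmf i))) (count_space UNIV)"
  using measurable_component_singleton[OF assms, of "\<lambda>i. measure_pmf (draw_pmf i)"]
  by (simp cong: measurable_cong_sets)

lemma draw_nbr_meas:
  assumes "{(k, l) |l. True} \<subseteq> J"
  shows "(\<lambda>\<omega>. draw_nbr \<omega> k E) \<in> measurable (PiM J (\<lambda>i. measure_pmf (draw_pmf i))) (count_space UNIV)"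
proof -
  have *: "(\<lambda>\<omega>. \<omega> (k, l)) \<in> measurable (PiM J (\<lambda>i. measure_pmf (draw_pmf i))) (count_space UNIV)" for l
    by (rule draw_coord_meas) (use assms in auto)
  show ?thesis unfolding draw_nbr_def
    by (rule measurable_compose_countable[OF * *])
qed

lemma draw_tree_meas:
  assumes "{(k, l) |k l. k < n} \<subseteq> J"
  shows "draw_tree n \<in> measurable (PiM J (\<lambda>i. measure_pmf (draw_pmf i))) (count_space draw_graphs)"
  using assms
proof (induction n)
  case 0
  show ?case by (auto simp: draw_graphs_def intro!: measurable_const)
next
  case (Suc n)
  have IH: "draw_tree n \<in> measurable (PiM J (\<lambda>i. measure_pmf (draw_pmf i))) (count_space draw_graphs)"
    using Suc.prems by (intro Suc.IH) auto
  have m: "(\<lambda>\<omega>. insert {draw_nbr \<omega> n E, Suc n} E) \<in> measurable (PiM J (\<lambda>i. measure_pmf (draw_pmf i))) (count_space draw_graphs)"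
    if "E \<in> draw_graphs" for E
    apply (rule measurable_compose[OF draw_nbr_meas])
    using that Suc.prems by (auto simp: draw_graphs_def)
  show ?case
  proof (cases "n < 2")
    case False
    have "(\<lambda>\<omega>. insert {draw_nbr \<omega> n (draw_tree n \<omega>), Suc n} (draw_tree n \<omega>)) \<in> measurable (PiM J (\<lambda>i. measure_pmf (draw_pmf i))) (count_space draw_graphs)"
      by (rule measurable_compose_countable'[OF m IH countable_draw_graphs])
    with False show ?thesis by (simp cong: measurable_cong)
  qed (auto simp: draw_graphs_def intro!: measurable_const)
qed

abbreviation "draw_V \<equiv> (\<lambda>n \<omega>::draw \<Rightarrow> nat. \<omega> (n, None))"
abbreviation "draw_W \<equiv> (\<lambda>n \<omega>. draw_nbr \<omega> n (draw_tree n \<omega>))"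

lemma draw_W_meas:
  assumes "{(k, l) |k l. k \<le> n} \<subseteq> J"
  shows "draw_W n \<in> measurable (PiM J (\<lambda>i. measure_pmf (draw_pmf i))) (count_space UNIV)"
  apply (rule measurable_compose_countable'[OF _ _ countable_draw_graphs])
  apply (rule draw_nbr_meas)
  using assms apply auto[1]
  apply (rule draw_tree_meas)
  using assms by auto

lemma draw_past_meas:
  assumes "{(k, l) |k l. k < n} \<subseteq> J"
  shows "Measurable.pred (PiM J (\<lambda>i. measure_pmf (draw_pmf i))) (past draw_V draw_W draw_tree n E vs ws)"
proof -
  have 1: "Measurable.pred (PiM J (\<lambda>i. measure_pmf (draw_pmf i))) (\<lambda>\<omega>. draw_tree n \<omega> = E)"
    by (rule measurable_compose[OF draw_tree_meas]) (use assms in auto)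
  have 2: "Measurable.pred (PiM J (\<lambda>i. measure_pmf (draw_pmf i))) (\<lambda>\<omega>. draw_V k \<omega> = vs k)" if "k < n" for k
  proof -
    have "(\<lambda>\<omega>. draw_V k \<omega>) \<in> measurable (PiM J (\<lambda>i. measure_pmf (draw_pmf i))) (count_space UNIV)"
      by (rule draw_coord_meas) (use assms that in auto)
    then show ?thesis by (rule measurable_compose) auto
  qed
  have 3: "Measurable.pred (PiM J (\<lambda>i. measure_pmf (draw_pmf i))) (\<lambda>\<omega>. draw_W k \<omega> = ws k)" if "k < n" for k
    by (rule measurable_compose[OF draw_W_meas]) (use assms that in auto)
  show ?thesis
    unfolding past_def
    by (intro pred_intros_logic pred_intros_finite 1 2 3) auto
qed

lemma draw_indep:
  defines "P \<equiv> PiM UNIV (\<lambda>i. measure_pmf (draw_pmf i))"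
  shows "measure P {\<omega>\<in>space P. past draw_V draw_W draw_tree n E vs ws \<omega> \<and> \<omega> (n, None) = v \<and> \<omega> (n, Some l) = w}
    = measure P {\<omega>\<in>space P. past draw_V draw_W draw_tree n E vs ws \<omega>} * pmf (draw_pmf (n,None)) v * pmf (draw_pmf (n,Some l)) w"
    (is "_ = measure P ?past * _ * _")
  and "measure P {\<omega>\<in>space P. past draw_V draw_W draw_tree n E vs ws \<omega> \<and> \<omega> (n, None) = v}
    = measure P {\<omega>\<in>space P. past draw_V draw_W draw_tree n E vs ws \<omega>} * pmf (draw_pmf (n,None)) v"
proof -
  let ?N = "\<lambda>i. measure_pmf (draw_pmf i)"
  interpret product_prob_space ?N UNIV by unfold_locales
  interpret Q: prob_space P unfolding P_def by unfold_locales
  have coord: "distr P (?N i) (\<lambda>\<omega>. \<omega> i) = ?N i" for i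
    unfolding P_def by (rule PiM_component) simp
  have "(\<lambda>x::draw \<Rightarrow> nat. \<lambda>i\<in>UNIV. x i) = (\<lambda>x. x)"
    by (simp add: restrict_def)
  then have "distr P (PiM UNIV ?N) (\<lambda>x. \<lambda>i\<in>UNIV. x i) = P"
    by (simp only: P_def distr_id)
  moreover have "PiM UNIV (\<lambda>i. distr P (?N i) (\<lambda>\<omega>. \<omega> i)) = P"
    unfolding coord by (simp add: P_def)
  ultimately have ind: "Q.indep_vars ?N (\<lambda>i \<omega>. \<omega> i) UNIV"
    by (subst Q.indep_vars_iff_distr_eq_PiM') 
       (auto simp: P_def intro!: measurable_component_singleton)
  define K where "K = (\<lambda>j::nat. if j = 0 then {(k, l::nat list option) |k l. k < n} else if j = 1 then {(n, None)} else {(n, Some l)})"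
  define B where "B = (\<lambda>j::nat. if j = 0 then {\<omega>\<in>space (PiM (K 0) ?N). past draw_V draw_W draw_tree n E vs ws \<omega>}
     else if j = 1 then {\<omega>\<in>space (PiM (K 1) ?N). \<omega> (n, None) = v} else {\<omega>\<in>space (PiM (K 2) ?N). \<omega> (n, Some l) = w})"
  have dj: "disjoint_family_on K {0,1,2}" by (auto simp: disjoint_family_on_def K_def)
  have ind2: "Q.indep_vars (\<lambda>j. PiM (K j) ?N) (\<lambda>j \<omega>. restrict (\<lambda>i. \<omega> i) (K j)) {0,1,2}"
    by (rule Q.indep_vars_restrict[OF ind]) (use dj in auto)
  have single: "{\<omega>\<in>space (PiM J ?N). \<omega> i = x} \<in> sets (PiM J ?N)" if "i \<in> J" for i J x
    using measurable_sets[OF measurable_component_singleton[OF that, of ?N], of "{x}"]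
    by (auto simp: vimage_def Int_def conj_commute)
  have B: "B j \<in> sets (PiM (K j) ?N)" if "j \<in> {0,1,2}" for j
    using that draw_past_meas[of n "K 0" E vs ws] single[of "(n,None)" "K 1" v] single[of "(n,Some l)" "K 2" w]
    by (auto simp: B_def K_def pred_def)
  have pc: "past draw_V draw_W draw_tree n E vs ws (restrict \<omega> (K 0)) = past draw_V draw_W draw_tree n E vs ws \<omega>" for \<omega>
  proof -
    define \<eta> where "\<eta> = restrict \<omega> (K 0)"
    have r: "\<eta> (k, l) = \<omega> (k, l)" if "k < n" for k l
      using that by (simp add: \<eta>_def K_def)
    have t: "draw_tree k \<eta> = draw_tree k \<omega>" if "k \<le> n" for k
      by (rule draw_tree_cong) (use that r in auto)
    show ?thesis
      unfolding \<eta>_def[symmetric] past_def draw_nbr_def by (auto simp: t r)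
  qed
  have v0: "(\<lambda>\<omega>. restrict (\<lambda>i. \<omega> i) (K 0)) -` B 0 \<inter> space P = ?past"
    using pc by (auto simp: B_def space_PiM P_def)
  have v1: "(\<lambda>\<omega>. restrict (\<lambda>i. \<omega> i) (K 1)) -` B 1 \<inter> space P = {\<omega>\<in>space P. \<omega> (n, None) = v}"
    by (auto simp: B_def space_PiM P_def K_def)
  have v2: "(\<lambda>\<omega>. restrict (\<lambda>i. \<omega> i) (K 2)) -` B 2 \<inter> space P = {\<omega>\<in>space P. \<omega> (n, Some l) = w}"
    by (auto simp: B_def space_PiM P_def K_def)
  have m: "measure P {\<omega>\<in>space P. \<omega> i = x} = pmf (draw_pmf i) x" for i x
  proof -
    have "measure (distr P (?N i) (\<lambda>\<omega>. \<omega> i)) {x} = measure P {\<omega>\<in>space P. \<omega> i = x}"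
      by (subst measure_distr) (auto simp: P_def vimage_def Int_def conj_commute measurable_component_singleton)
    then show ?thesis by (simp add: P_def PiM_component measure_pmf_single)
  qed
  have "measure P (\<Inter>j\<in>{0,1,2}. (\<lambda>\<omega>. restrict (\<lambda>i. \<omega> i) (K j)) -` B j \<inter> space P)
     = (\<Prod>j\<in>{0,1,2}. measure P ((\<lambda>\<omega>. restrict (\<lambda>i. \<omega> i) (K j)) -` B j \<inter> space P))"
    by (rule Q.indep_varsD[OF ind2]) (use B in auto)
  moreover have "(\<Inter>j\<in>{0,1,2}. (\<lambda>\<omega>. restrict (\<lambda>i. \<omega> i) (K j)) -` B j \<inter> space P)
     = {\<omega>\<in>space P. past draw_V draw_W draw_tree n E vs ws \<omega> \<and> \<omega> (n, None) = v \<and> \<omega> (n, Some l) = w}"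
    using v0 v1 v2 by auto
  ultimately show "measure P {\<omega>\<in>space P. past draw_V draw_W draw_tree n E vs ws \<omega> \<and> \<omega> (n, None) = v \<and> \<omega> (n, Some l) = w}
    = measure P ?past * pmf (draw_pmf (n,None)) v * pmf (draw_pmf (n,Some l)) w"
    by (simp add: v0 v1[simplified] v2 m)
  have "measure P (\<Inter>j\<in>{0,1}. (\<lambda>\<omega>. restrict (\<lambda>i. \<omega> i) (K j)) -` B j \<inter> space P)
     = (\<Prod>j\<in>{0,1}. measure P ((\<lambda>\<omega>. restrict (\<lambda>i. \<omega> i) (K j)) -` B j \<inter> space P))"
    by (rule Q.indep_varsD[OF ind2]) (use B in auto)
  moreover have "(\<Inter>j\<in>{0,1}. (\<lambda>\<omega>. restrict (\<lambda>i. \<omega> i) (K j)) -` B j \<inter> space P)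
     = {\<omega>\<in>space P. past draw_V draw_W draw_tree n E vs ws \<omega> \<and> \<omega> (n, None) = v}"
    using v0 v1 by auto
  ultimately show "measure P {\<omega>\<in>space P. past draw_V draw_W draw_tree n E vs ws \<omega> \<and> \<omega> (n, None) = v}
    = measure P ?past * pmf (draw_pmf (n,None)) v"
    by (simp add: v0 v1[simplified] m)
qed

theorem random_friend_tree_exists:
  "random_friend_tree (PiM UNIV (\<lambda>i. measure_pmf (draw_pmf i))) draw_V draw_W draw_tree"
proof -
  let ?N = "\<lambda>i. measure_pmf (draw_pmf i)"
  define P where "P = PiM UNIV ?N"
  interpret product_prob_space ?N UNIV by unfold_locales
  interpret Q: prob_space P unfolding P_def by unfold_locales
  show ?thesis unfolding P_def[symmetric]
  proof unfold_locales
    fix n :: nat assume n: "2 \<le> n"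
    show "draw_V n \<in> measurable P (count_space UNIV)"
      unfolding P_def by (rule draw_coord_meas) auto
    show "draw_W n \<in> measurable P (count_space UNIV)"
      unfolding P_def by (rule draw_W_meas) auto
    show "draw_tree (Suc n) \<omega> = insert {draw_W n \<omega>, Suc n} (draw_tree n \<omega>)" for \<omega>
      using n by auto
    have pV: "pmf (draw_pmf (n, None)) v = 1 / real n" if "v \<in> {1..n}" for v
      using that n by (simp add: draw_pmf_def pmf_of_set)
    fix E vs ws v
    let ?p = "past draw_V draw_W draw_tree n E vs ws"
    {
      assume p: "\<P>(\<omega> in P. ?p \<omega>) > 0" and v: "v \<in> {1..n}"
      have "{\<omega>\<in>space P. \<omega> (n, None) = v \<and> ?p \<omega>} = {\<omega>\<in>space P. ?p \<omega> \<and> \<omega> (n, None) = v}" by auto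
      then show "\<P>(\<omega> in P. \<omega> (n, None) = v \<bar> ?p \<omega>) = 1 / real n"
        using p v n draw_indep(2)[of n E vs ws v, folded P_def]
        by (simp add: cond_prob_def pV)
    next
      fix w
      assume p: "\<P>(\<omega> in P. ?p \<omega> \<and> \<omega> (n, None) = v) > 0" and w: "w \<in> nbrs E v"
      let ?l = "sorted_list_of_set (nbrs E v)"
      have "\<exists>\<omega>. ?p \<omega>"
      proof (rule ccontr)
        assume "\<not> ?thesis"
        then have "{\<omega>\<in>space P. ?p \<omega> \<and> \<omega> (n, None) = v} = {}" by auto
        with p show False by (simp only: measure_empty)
      qed
      then have "finite E" using finite_draw_tree by (auto simp: past_def)
      then have f: "finite (nbrs E v)" by (rule finite_nbrs)
      have ne: "nbrs E v \<noteq> {}" using w by auto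
      have pW: "pmf (draw_pmf (n, Some ?l)) w = 1 / real (vertex_degree E v)"
        using f w ne by (simp add: draw_pmf_def pmf_of_set vertex_degree_def)
      have "{\<omega>\<in>space P. draw_W n \<omega> = w \<and> ?p \<omega> \<and> \<omega> (n, None) = v}
        = {\<omega>\<in>space P. ?p \<omega> \<and> \<omega> (n, None) = v \<and> \<omega> (n, Some ?l) = w}"
        by (auto simp: past_def draw_nbr_def)
      then show "\<P>(\<omega> in P. draw_W n \<omega> = w \<bar> ?p \<omega> \<and> \<omega> (n, None) = v) = 1 / real (vertex_degree E v)"
        using p pW draw_indep[of n E vs ws v, folded P_def]
        by (auto simp: cond_prob_def)
    }
  qed (simp add: numeral_2_eq_2)
qed

end

theory Submission
  imports Defs "HOL-Real_Asymp.Real_Asymp"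
begin

text \<open>
  Both bounds come from averaging a well chosen function of the tree over one step of the process
  (\<open>friend_avg\<close>) and from Markov's inequality at the end. Throughout, \<open>V\<close> is the uniform vertex and
  \<open>W\<close> its uniform neighbour, to which the new leaf is attached.

  \<^bold>\<open>Upper bound.\<close> Fix a vertex \<open>i\<close>, let \<open>d\<close> be its distance to the nearest leaf and \<open>l\<close> a leaf that
  attains it. The distance can only grow if \<open>W = l\<close>, and then by one; since \<open>l\<close> has a single
  neighbour, this has probability at most \<open>1/n\<close>. On the other hand, for \<open>r \<le> d\<close> the ball of radius
  \<open>r\<close> around \<open>i\<close> contains at least \<open>r + 1\<close> vertices (one on each level of a shortest path to \<open>l\<close>),
  and if \<open>V\<close> falls into this ball then the new leaf is within distance \<open>r + 2\<close> of \<open>i\<close>. So in one step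
  \<open>d\<close> climbs one level with probability at most \<open>1/n\<close> but falls to about \<open>d/2\<close> with probability at
  least \<open>d/(2n)\<close>, and a function of factorial growth still has bounded drift:
  \<open>growth_leaf_dist_step\<close>. Summed over all vertices, its expectation is linear in \<open>n\<close> (\<open>leaf_potential_linear\<close>), whereas a single vertex
  at distance \<open>8 log n / log log n\<close> would contribute at least \<open>n\<close> to the power \<open>4 - o(1)\<close>.

  \<^bold>\<open>Lower bound.\<close> A leaf \<open>l\<close> carries a pendant chain of length \<open>k\<close> if its \<open>k\<close> nearest ancestors all
  have degree two and none of them is the root \<open>1\<close>; the middle of such a chain is at distance at least \<open>k div 2\<close> from every leaf
  (\<open>max_leaf_dist_ge_chain\<close>). A chain gets longer when \<open>W\<close> is its leaf, which has probability
  \<open>1/(2n)\<close>, and it is spoilt only if \<open>W\<close> is one of its vertices of degree two, which has probability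
  at most \<open>2k/n\<close>. Chains are born when \<open>W\<close> is an arbitrary leaf, with probability \<open>H/n\<close> where \<open>H\<close> is
  the sum of \<open>1/deg(u)\<close> over all leaves, \<open>u\<close> being the neighbour of the leaf. This quantity
  (\<open>leaf_rate\<close>) never decreases from time \<open>3\<close> on and, from time \<open>4\<close> on,
  grows by at least \<open>H/(6n)\<close> on average, whence the expectation
  of \<open>1/H\<close> decays polynomially and \<open>H\<close> is at least a power of \<open>n\<close> with high probability
  (\<open>prob_leaf_rate_small\<close>).

  A chain born slightly after time \<open>N/2\<close> reaches length \<open>k\<close> by time \<open>N\<close> with probability at least
  \<open>exp (- 20 k - k log (16 k))\<close>. For \<open>k = c log N / log log N\<close> with small \<open>c\<close> this is a small negative
  power of \<open>N\<close>, so many chains of length \<open>k\<close> are expected. They are not independent. However, a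
  vertex lies on at most one pendant chain (\<open>chain_tip_unique\<close>), so one step affects at most one
  chain, and \<open>exp (- \<Phi>/2)\<close> is a supermartingale, where \<open>\<Phi>\<close> is the sum, over the present chains, of lower
  bounds for their chances of reaching length \<open>k\<close>, plus the expected contribution of the chains
  still to be born (\<open>chain_functional_step\<close>). This bounds the probability that no chain of length
  \<open>k\<close> exists at time \<open>N\<close> (\<open>prob_no_chain_le\<close>).

  The argument is carried out for the Markov chain of trees with explicit one-step law
  (\<open>friend_pmf\<close>); the lemma \<open>prob_T\<close> transfers it to any process satisfying the
  hypotheses.
\<close>

section \<open>Trees grown by attaching leaves\<close>

text \<open>Every tree of the process is given by the vertex \<open>p x < x\<close> to which \<open>x\<close> was attached on arrival;
  rooted at \<open>1\<close>, this is the parent of \<open>x\<close>.\<close>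

locale rec_tree =
  fixes n :: nat and E :: "nat set set" and p :: "nat \<Rightarrow> nat"
  assumes n_ge_2: "2 \<le> n"
    and parent: "\<And>x. x \<in> {2..n} \<Longrightarrow> p x \<in> {1..<x}"
    and edges: "E = (\<lambda>x. {p x, x}) ` {2..n}"
begin

lemma finite_edges: "finite E"
  by (simp add: edges)

lemma edge_iff: "{u, v} \<in> E \<longleftrightarrow> (u \<in> {2..n} \<and> p u = v) \<or> (v \<in> {2..n} \<and> p v = u)"
  by (auto simp: edges doubleton_eq_iff image_iff)

lemma nbrs_eq: "nbrs E v = {x \<in> {2..n}. p x = v} \<union> (if v \<in> {2..n} then {p v} else {})"
  by (auto simp: nbrs_def edge_iff)

lemma nbrs_sym: "u \<in> nbrs E v \<longleftrightarrow> v \<in> nbrs E u"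
  by (simp add: nbrs_def insert_commute)

lemma nbrs_subset: "nbrs E v \<subseteq> {1..n}"
  using parent by (fastforce simp: nbrs_eq split: if_splits)

lemma nbrs_vertex: "u \<in> nbrs E v \<Longrightarrow> v \<in> {1..n}"
  using nbrs_sym nbrs_subset by blast

lemma finite_nbrs_tree [simp]: "finite (nbrs E v)"
  by (rule finite_nbrs[OF finite_edges])

lemma not_self_nbr: "v \<notin> nbrs E v"
  using parent[of v] by (auto simp: nbrs_eq split: if_splits)

lemma nbrs_nonempty: "v \<in> {1..n} \<Longrightarrow> nbrs E v \<noteq> {}"
  using parent[of 2] n_ge_2 by (cases "v = 1") (auto simp: nbrs_eq intro!: exI[of _ 2])

lemma degree_pos: "v \<in> {1..n} \<Longrightarrow> vertex_degree E v \<ge> 1"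
  using nbrs_nonempty[of v] by (simp add: vertex_degree_def Suc_le_eq card_gt_0_iff)

lemma attach:
  assumes "w \<in> {1..n}"
  shows "rec_tree (Suc n) (insert {w, Suc n} E) (p(Suc n := w))"
proof
  show "(p(Suc n := w)) x \<in> {1..<x}" if "x \<in> {2..Suc n}" for x
    using that assms parent[of x] by (cases "x = Suc n") auto
  have "{2..Suc n} = insert (Suc n) {2..n}" using n_ge_2 by auto
  then show "insert {w, Suc n} E = (\<lambda>x. {(p(Suc n := w)) x, x}) ` {2..Suc n}"
    by (auto simp: edges image_iff)
qed (use n_ge_2 in auto)

lemma nbrs_attach:
  assumes "w \<in> {1..n}"
  shows "nbrs (insert {w, Suc n} E) v =
    (if v = w then insert (Suc n) (nbrs E w) else if v = Suc n then {w} else nbrs E v)"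
  using assms nbrs_subset[of "Suc n"] nbrs_vertex[of _ "Suc n"]
  by (auto simp: nbrs_def doubleton_eq_iff)

lemma degree_attach:
  assumes "w \<in> {1..n}"
  shows "vertex_degree (insert {w, Suc n} E) v =
    (if v = w then Suc (vertex_degree E w) else if v = Suc n then 1 else vertex_degree E v)"
proof -
  have "Suc n \<notin> nbrs E w" using nbrs_subset[of w] by auto
  then show ?thesis by (simp add: vertex_degree_def nbrs_attach[OF assms])
qed

text \<open>Connectedness in the form needed below: following parents leads from any vertex to \<open>1\<close>, and
  from \<open>1\<close> every vertex is reached in the order of labels.\<close>

lemma all_vertices_if_closed:
  assumes "x \<in> S" "x \<in> {1..n}" and closed: "\<And>u. u \<in> S \<Longrightarrow> nbrs E u \<subseteq> S"
  shows "{1..n} \<subseteq> S"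
proof -
  have "x \<in> {1..n} \<longrightarrow> x \<in> S \<longrightarrow> 1 \<in> S" for x
  proof (induction x rule: less_induct)
    case (less x)
    show ?case
    proof (intro impI)
      assume x: "x \<in> {1..n}" "x \<in> S"
      show "1 \<in> S"
      proof (cases "x = 1")
        case False
        then have "x \<in> {2..n}" using x by auto
        then have "p x \<in> S" "p x \<in> {1..<x}" using closed[OF x(2)] parent[of x] by (auto simp: nbrs_eq)
        then show ?thesis using less[of "p x"] x by auto
      qed (use x in simp)
    qed
  qed
  then have 1: "1 \<in> S" using assms by blast
  have "y \<in> {1..n} \<longrightarrow> y \<in> S" for y
  proof (induction y rule: less_induct)
    case (less y)
    show ?case
    proof (cases "y \<in> {2..n}")
      case True
      then have "p y \<in> S" using less[of "p y"] parent[of y] by auto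
      moreover have "y \<in> nbrs E (p y)" using True by (auto simp: nbrs_eq)
      ultimately show ?thesis using closed by blast
    next
      case False
      then have "y \<in> {1..n} \<Longrightarrow> y = 1" by auto
      with 1 show ?thesis by blast
    qed
  qed
  then show ?thesis by blast
qed

end

section \<open>The Markov chain of trees\<close>

definition friend_step :: "nat \<Rightarrow> nat set set \<Rightarrow> nat set set pmf" where
  "friend_step n E = bind_pmf (pmf_of_set {1..n})
     (\<lambda>v. map_pmf (\<lambda>w. insert {w, Suc n} E) (pmf_of_set (nbrs E v)))"

fun friend_pmf :: "nat \<Rightarrow> nat set set pmf" where
  "friend_pmf 0 = return_pmf {{1, 2}}"
| "friend_pmf (Suc n) =
    (if n < 2 then return_pmf {{1, 2}} else bind_pmf (friend_pmf n) (friend_step n))"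

definition is_rec_tree :: "nat \<Rightarrow> nat set set \<Rightarrow> bool" where
  "is_rec_tree n E \<longleftrightarrow> (\<exists>p. rec_tree n E p)"

text \<open>The conditional expectation of \<open>G V W\<close> given that the current tree is \<open>E\<close>.\<close>

definition friend_avg :: "nat \<Rightarrow> nat set set \<Rightarrow> (nat \<Rightarrow> nat \<Rightarrow> real) \<Rightarrow> real" where
  "friend_avg n E G = (\<Sum>v\<in>{1..n}. \<Sum>w\<in>nbrs E v. G v w / (real n * real (vertex_degree E v)))"

lemma set_friend_step:
  assumes "rec_tree n E p"
  shows "finite (set_pmf (friend_step n E))" "E' \<in> set_pmf (friend_step n E) \<Longrightarrow> is_rec_tree (Suc n) E'"
proof -
  interpret rec_tree n E p by fact
  have s: "set_pmf (friend_step n E) = (\<Union>v\<in>{1..n}. (\<lambda>w. insert {w, Suc n} E) ` nbrs E v)"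
    unfolding friend_step_def using n_ge_2 nbrs_nonempty
    by (auto simp: set_pmf_of_set)
  show "finite (set_pmf (friend_step n E))" unfolding s by auto
  assume "E' \<in> set_pmf (friend_step n E)"
  then obtain w where "w \<in> {1..n}" "E' = insert {w, Suc n} E" unfolding s using nbrs_subset by blast
  then show "is_rec_tree (Suc n) E'" using attach by (auto simp: is_rec_tree_def)
qed

lemma friend_pmf_support:
  assumes "2 \<le> n"
  shows "finite (set_pmf (friend_pmf n)) \<and> (\<forall>E\<in>set_pmf (friend_pmf n). is_rec_tree n E)"
  using assms
proof (induction n rule: dec_induct)
  case base
  have "rec_tree 2 {{1, 2}} (\<lambda>x. 1)" by unfold_locales auto
  then show ?case by (auto simp: numeral_2_eq_2 is_rec_tree_def)
next
  case (step n)
  then show ?case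
    by (auto simp: is_rec_tree_def[of n] intro: set_friend_step)
qed

lemma friend_step_expectation:
  assumes "rec_tree n E p"
  shows "measure_pmf.expectation (friend_step n E) g = friend_avg n E (\<lambda>v w. g (insert {w, Suc n} E))"
proof -
  interpret rec_tree n E p by fact
  have "measure_pmf.expectation (friend_step n E) g = (\<Sum>v\<in>{1..n}. pmf (pmf_of_set {1..n}) v *\<^sub>R
      measure_pmf.expectation (map_pmf (\<lambda>w. insert {w, Suc n} E) (pmf_of_set (nbrs E v))) g)"
    unfolding friend_step_def using n_ge_2 nbrs_nonempty
    by (intro pmf_expectation_bind) auto
  also have "\<dots> = friend_avg n E (\<lambda>v w. g (insert {w, Suc n} E))"
    unfolding friend_avg_def
  proof (intro sum.cong refl)
    fix v assume v: "v \<in> {1..n}"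
    show "pmf (pmf_of_set {1..n}) v *\<^sub>R
      measure_pmf.expectation (map_pmf (\<lambda>w. insert {w, Suc n} E) (pmf_of_set (nbrs E v))) g
      = (\<Sum>w\<in>nbrs E v. g (insert {w, Suc n} E) / (real n * real (vertex_degree E v)))"
      using v nbrs_nonempty[OF v]
      by (simp add: integral_pmf_of_set vertex_degree_def sum_divide_distrib mult.commute)
  qed
  finally show ?thesis .
qed

lemma friend_pmf_expectation_Suc:
  assumes "2 \<le> n"
  shows "measure_pmf.expectation (friend_pmf (Suc n)) g =
    (\<Sum>E\<in>set_pmf (friend_pmf n). pmf (friend_pmf n) E * friend_avg n E (\<lambda>v w. g (insert {w, Suc n} E)))"
proof -
  have s: "finite (set_pmf (friend_pmf n))" "\<And>E. E \<in> set_pmf (friend_pmf n) \<Longrightarrow> \<exists>p. rec_tree n E p"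
    using friend_pmf_support[OF assms] by (auto simp: is_rec_tree_def)
  have "measure_pmf.expectation (friend_pmf (Suc n)) g = (\<Sum>E\<in>set_pmf (friend_pmf n). pmf (friend_pmf n) E *\<^sub>R
      measure_pmf.expectation (friend_step n E) g)"
  proof -
    have "friend_pmf (Suc n) = bind_pmf (friend_pmf n) (friend_step n)" using assms by simp
    then show ?thesis using s set_friend_step(1)
      by (simp only:, intro pmf_expectation_bind) blast+
  qed
  also have "\<dots> = (\<Sum>E\<in>set_pmf (friend_pmf n). pmf (friend_pmf n) E * friend_avg n E (\<lambda>v w. g (insert {w, Suc n} E)))"
    by (intro sum.cong refl) (use s(2) friend_step_expectation in fastforce)
  finally show ?thesis .
qed

text \<open>Every recursive estimate on expectations is obtained from this one-step comparison, so that only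
  deterministic inequalities about a fixed tree remain.\<close>

lemma friend_pmf_expectation_le:
  assumes n: "2 \<le> n"
    and step: "\<And>E p. rec_tree n E p \<Longrightarrow> friend_avg n E (\<lambda>v w. g' (insert {w, Suc n} E)) \<le> a * g E + b"
  shows "measure_pmf.expectation (friend_pmf (Suc n)) g' \<le> a * measure_pmf.expectation (friend_pmf n) g + b"
proof -
  let ?S = "set_pmf (friend_pmf n)"
  have s: "finite ?S" "\<And>E. E \<in> ?S \<Longrightarrow> \<exists>p. rec_tree n E p"
    using friend_pmf_support[OF n] by (auto simp: is_rec_tree_def)
  have "measure_pmf.expectation (friend_pmf (Suc n)) g' \<le> (\<Sum>E\<in>?S. pmf (friend_pmf n) E * (a * g E + b))"
    unfolding friend_pmf_expectation_Suc[OF n]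
    using s(2) step by (intro sum_mono mult_left_mono) (blast, auto)
  also have "\<dots> = a * (\<Sum>E\<in>?S. pmf (friend_pmf n) E * g E) + b * (\<Sum>E\<in>?S. pmf (friend_pmf n) E)"
    by (simp add: algebra_simps sum.distrib sum_distrib_left)
  also have "(\<Sum>E\<in>?S. pmf (friend_pmf n) E) = 1"
    using s(1) by (rule sum_pmf_eq_1) auto
  also have "(\<Sum>E\<in>?S. pmf (friend_pmf n) E * g E) = measure_pmf.expectation (friend_pmf n) g"
    using s(1) by (subst integral_measure_pmf[of ?S]) auto
  finally show ?thesis by simp
qed

context rec_tree
begin

lemma friend_avg_mono:
  assumes "\<And>v w. v \<in> {1..n} \<Longrightarrow> w \<in> nbrs E v \<Longrightarrow> G v w \<le> G' v w"
  shows "friend_avg n E G \<le> friend_avg n E G'"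
  unfolding friend_avg_def by (intro sum_mono divide_right_mono assms) auto

lemma friend_avg_add: "friend_avg n E (\<lambda>v w. G v w + G' v w) = friend_avg n E G + friend_avg n E G'"
  by (simp add: friend_avg_def add_divide_distrib sum.distrib)

lemma friend_avg_diff: "friend_avg n E (\<lambda>v w. G v w - G' v w) = friend_avg n E G - friend_avg n E G'"
  by (simp add: friend_avg_def diff_divide_distrib sum_subtractf)

lemma friend_avg_cmult: "friend_avg n E (\<lambda>v w. c * G v w) = c * friend_avg n E G"
  by (simp add: friend_avg_def sum_distrib_left)

lemma friend_avg_sum: "friend_avg n E (\<lambda>v w. \<Sum>i\<in>I. G i v w) = (\<Sum>i\<in>I. friend_avg n E (G i))"
  by (induction I rule: infinite_finite_induct) (simp_all add: friend_avg_add, simp_all add: friend_avg_def)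

lemma friend_avg_fst: "friend_avg n E (\<lambda>v w. G v) = (\<Sum>v\<in>{1..n}. G v) / n"
proof -
  have "(\<Sum>w\<in>nbrs E v. G v / (real n * real (vertex_degree E v))) = G v / n" if "v \<in> {1..n}" for v
    using nbrs_nonempty[OF that] by (simp add: vertex_degree_def)
  then show ?thesis by (simp add: friend_avg_def sum_divide_distrib)
qed

lemma friend_avg_const: "friend_avg n E (\<lambda>v w. c) = c"
  using n_ge_2 by (simp add: friend_avg_fst)

text \<open>The conditional probability that \<open>W = w\<close>.\<close>

definition attach_prob :: "nat \<Rightarrow> real" where
  "attach_prob w = (\<Sum>v\<in>nbrs E w. 1 / (real n * real (vertex_degree E v)))"

lemma friend_avg_snd: "friend_avg n E (\<lambda>v w. G w) = (\<Sum>w\<in>{1..n}. G w * attach_prob w)"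
proof -
  have "friend_avg n E (\<lambda>v w. G w) = (\<Sum>v\<in>{1..n}. \<Sum>w\<in>{w\<in>{1..n}. w \<in> nbrs E v}. G w / (real n * real (vertex_degree E v)))"
  proof -
    have "{w\<in>{1..n}. w \<in> nbrs E v} = nbrs E v" for v using nbrs_subset[of v] by blast
    then show ?thesis by (simp only: friend_avg_def)
  qed
  also have "\<dots> = (\<Sum>w\<in>{1..n}. \<Sum>v\<in>{v\<in>{1..n}. w \<in> nbrs E v}. G w / (real n * real (vertex_degree E v)))"
    by (rule sum.swap_restrict) auto
  also have "\<dots> = (\<Sum>w\<in>{1..n}. \<Sum>v\<in>nbrs E w. G w / (real n * real (vertex_degree E v)))"
  proof -
    have "{v\<in>{1..n}. w \<in> nbrs E v} = nbrs E w" for w using nbrs_subset[of w] nbrs_sym by blast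
    then show ?thesis by (simp only:)
  qed
  finally show ?thesis by (simp add: attach_prob_def sum_distrib_left)
qed

lemma leaf_nbrs: "l \<in> leaves n E \<Longrightarrow> \<exists>u\<in>{1..n}. nbrs E l = {u}"
  using nbrs_subset[of l] by (auto simp: leaves_def vertex_degree_def card_1_singleton_iff)

lemma leaf_attach_prob: "nbrs E l = {u} \<Longrightarrow> attach_prob l = 1 / (real n * real (vertex_degree E u))"
  by (simp add: attach_prob_def)

lemma last_is_leaf: "n \<in> leaves n E"
proof -
  have "nbrs E n = {p n}" using parent n_ge_2 by (fastforce simp: nbrs_eq)
  then show ?thesis using n_ge_2 by (simp add: leaves_def vertex_degree_def)
qed

lemma finite_leaves [simp]: "finite (leaves n E)"
  by (simp add: leaves_def)

lemma leaves_attach: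
  assumes "w \<in> {1..n}"
  shows "leaves (Suc n) (insert {w, Suc n} E) = insert (Suc n) (leaves n E - {w})"
  using assms degree_pos[OF assms] by (auto simp: leaves_def degree_attach[OF assms] le_Suc_eq)

end

lemma friend_pmf_Markov:
  assumes n: "2 \<le> n" and c: "c > 0"
    and ge: "\<And>E p. rec_tree n E p \<Longrightarrow> E \<in> A \<Longrightarrow> c \<le> g E"
    and nonneg: "\<And>E p. rec_tree n E p \<Longrightarrow> 0 \<le> g E"
  shows "measure_pmf.prob (friend_pmf n) A \<le> measure_pmf.expectation (friend_pmf n) g / c"
proof -
  have fin: "finite (set_pmf (friend_pmf n))" using friend_pmf_support[OF n] by blast
  have "measure_pmf.prob (friend_pmf n) A = measure_pmf.expectation (friend_pmf n) (indicator A)" by simp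
  also have "\<dots> \<le> measure_pmf.expectation (friend_pmf n) (\<lambda>E. g E / c)"
  proof (rule integral_mono_AE)
    show "AE E in measure_pmf (friend_pmf n). indicat_real A E \<le> g E / c"
    proof (rule AE_pmfI)
      fix E assume "E \<in> set_pmf (friend_pmf n)"
      then obtain p where "rec_tree n E p" using friend_pmf_support[OF n] by (auto simp: is_rec_tree_def)
      then show "indicat_real A E \<le> g E / c" using ge[of E p] nonneg[of E p] c by (auto simp: indicator_def)
    qed
  qed (use fin in \<open>auto intro: integrable_measure_pmf_finite\<close>)
  finally show ?thesis by simp
qed

section \<open>The law of the process\<close>

context random_friend_tree
begin

definition history :: "nat \<Rightarrow> 'a \<Rightarrow> (nat \<times> nat) list" where
  "history n \<omega> = map (\<lambda>k. (V k \<omega>, W k \<omega>)) [2..<n]"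

text \<open>The atoms of the past correspond to the countably many possible histories, which turns
  conditioning on the past into a countable sum.\<close>

lemma history_eq_iff:
  "history n \<omega> = h \<longleftrightarrow> length h = n - 2 \<and>
     (\<forall>k\<in>{2..<n}. V k \<omega> = fst (h ! (k - 2)) \<and> W k \<omega> = snd (h ! (k - 2)))"
proof -
  have "(\<forall>k\<in>{2..<n}. Q k (k - 2)) \<longleftrightarrow> (\<forall>i<n - 2. Q (2 + i) i)" for Q :: "nat \<Rightarrow> nat \<Rightarrow> bool"
  proof (intro iffI ballI allI impI)
    fix i assume "\<forall>k\<in>{2..<n}. Q k (k - 2)" "i < n - 2"
    then show "Q (2 + i) i" by (auto dest!: bspec[of _ _ "2 + i"])
  next
    fix k assume *: "\<forall>i<n - 2. Q (2 + i) i" "k \<in> {2..<n}"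
    then have "Q (2 + (k - 2)) (k - 2)" by auto
    moreover have "2 + (k - 2) = k" using * by auto
    ultimately show "Q k (k - 2)" by (simp only:)
  qed
  from this[of "\<lambda>k i. V k \<omega> = fst (h ! i) \<and> W k \<omega> = snd (h ! i)"]
  show ?thesis
    unfolding history_def list_eq_iff_nth_eq
    by (auto simp: prod_eq_iff)
qed

lemma history_measurable: "history n \<in> measurable M (count_space UNIV)"
proof (rule measurable_count_space_eq2_countable[THEN iffD2])
  have "Measurable.pred M (\<lambda>\<omega>. history n \<omega> = h)" for h
    unfolding history_eq_iff
    apply (intro pred_intros_logic pred_intros_finite)
    using V_measurable W_measurable by auto
  then show "history n \<in> space M \<rightarrow> UNIV \<and> (\<forall>a\<in>UNIV. history n -` {a} \<inter> space M \<in> sets M)"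
    by (auto simp: pred_def vimage_def Int_def conj_commute)
qed

lemma T_eq:
  assumes "2 \<le> n" "\<omega> \<in> space M"
  shows "T n \<omega> = insert {1, 2} ((\<lambda>k. {W k \<omega>, Suc k}) ` {2..<n})"
  using assms(1)
proof (induction n rule: dec_induct)
  case base then show ?case using T_2 assms(2) by simp
next
  case (step n)
  have "{2..<Suc n} = insert n {2..<n}" using step by auto
  then show ?case using step T_Suc[of n \<omega>] assms(2) by auto
qed

lemma T_event: 
  assumes "2 \<le> n"
  shows "{\<omega> \<in> space M. T n \<omega> \<in> A} \<in> events"
proof -
  let ?F = "\<lambda>h. insert {1, 2} ((\<lambda>k. {snd (h ! (k - 2)), Suc k}) ` {2..<n})"
  have "T n \<omega> = ?F (history n \<omega>)" if "\<omega> \<in> space M" for \<omega>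
  proof -
    have "W k \<omega> = snd (history n \<omega> ! (k - 2))" if "k \<in> {2..<n}" for k
      using history_eq_iff[of n \<omega> "history n \<omega>"] that by blast
    then show ?thesis using T_eq[OF assms that] by auto
  qed
  then have "{\<omega> \<in> space M. T n \<omega> \<in> A} = history n -` (?F -` A) \<inter> space M"
    by auto
  then show ?thesis using measurable_sets[OF history_measurable] by simp
qed

lemma step_event:
  assumes "2 \<le> n"
  shows "{\<omega> \<in> space M. T n \<omega> = E \<and> V n \<omega> = v \<and> W n \<omega> = w} \<in> events"
proof -
  have "Measurable.pred M (\<lambda>\<omega>. T n \<omega> = E)" using T_event[OF assms, of "{E}"] by (simp add: pred_def)
  moreover have "Measurable.pred M (\<lambda>\<omega>. V n \<omega> = v)" "Measurable.pred M (\<lambda>\<omega>. W n \<omega> = w)"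
    using V_measurable[OF assms] W_measurable[OF assms] by auto
  ultimately have "Measurable.pred M (\<lambda>\<omega>. T n \<omega> = E \<and> V n \<omega> = v \<and> W n \<omega> = w)" by auto
  then show ?thesis by (simp add: pred_def)
qed

lemma prob_step_past:
  assumes n: "2 \<le> n" and v: "v \<in> {1..n}" and w: "w \<in> nbrs E v"
  shows "\<P>(\<omega> in M. past V W T n E vs ws \<omega> \<and> V n \<omega> = v \<and> W n \<omega> = w)
    = \<P>(\<omega> in M. past V W T n E vs ws \<omega>) / (real n * real (vertex_degree E v))"
proof -
  let ?p = "past V W T n E vs ws"
  have "Measurable.pred M (\<lambda>\<omega>. T n \<omega> = E)" using T_event[OF n, of "{E}"] by (simp add: pred_def)
  then have m1: "Measurable.pred M ?p" unfolding past_def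
    by (intro pred_intros_logic pred_intros_finite) (use V_measurable W_measurable in auto)
  have m2: "Measurable.pred M (\<lambda>\<omega>. V n \<omega> = v)" "Measurable.pred M (\<lambda>\<omega>. W n \<omega> = w)"
    using V_measurable[OF n] W_measurable[OF n] by auto
  have ev: "{\<omega> \<in> space M. ?p \<omega>} \<in> events"
    using m1 by (simp add: pred_def)
  show ?thesis
  proof (cases "\<P>(\<omega> in M. ?p \<omega>) > 0")
    case True
    have 1: "\<P>(\<omega> in M. ?p \<omega> \<and> V n \<omega> = v) = \<P>(\<omega> in M. ?p \<omega>) / real n"
    proof -
      have "{\<omega> \<in> space M. ?p \<omega> \<and> V n \<omega> = v} = {\<omega> \<in> space M. V n \<omega> = v \<and> ?p \<omega>}" by auto
      then show ?thesis using V_uniform[OF n True v] True n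
        by (simp add: cond_prob_def field_simps)
    qed
    then have 2: "\<P>(\<omega> in M. ?p \<omega> \<and> V n \<omega> = v) > 0" using True n by simp
    have "{\<omega> \<in> space M. ?p \<omega> \<and> V n \<omega> = v \<and> W n \<omega> = w} = {\<omega> \<in> space M. W n \<omega> = w \<and> ?p \<omega> \<and> V n \<omega> = v}" by auto
    then have "\<P>(\<omega> in M. ?p \<omega> \<and> V n \<omega> = v \<and> W n \<omega> = w) / \<P>(\<omega> in M. ?p \<omega> \<and> V n \<omega> = v)
        = 1 / real (vertex_degree E v)"
      using W_uniform[OF n 2 w] by (simp only: cond_prob_def)
    then have "\<P>(\<omega> in M. ?p \<omega> \<and> V n \<omega> = v \<and> W n \<omega> = w)
        = 1 / real (vertex_degree E v) * \<P>(\<omega> in M. ?p \<omega> \<and> V n \<omega> = v)"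
      using 2 by (subst (asm) nonzero_divide_eq_eq) auto
    then show ?thesis unfolding 1 by simp
  next
    case False
    then have z: "\<P>(\<omega> in M. ?p \<omega>) = 0" using measure_nonneg[of M] by (metis less_eq_real_def)
    have "\<P>(\<omega> in M. ?p \<omega> \<and> V n \<omega> = v \<and> W n \<omega> = w) \<le> \<P>(\<omega> in M. ?p \<omega>)"
      by (rule finite_measure_mono) (use ev in auto)
    then show ?thesis using z by (simp add: measure_le_0_iff)
  qed
qed

lemma prob_step:
  assumes n: "2 \<le> n" and v: "v \<in> {1..n}" and w: "w \<in> nbrs E v"
  shows "\<P>(\<omega> in M. T n \<omega> = E \<and> V n \<omega> = v \<and> W n \<omega> = w)
    = \<P>(\<omega> in M. T n \<omega> = E) / (real n * real (vertex_degree E v))"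
proof -
  define c where "c = 1 / (real n * real (vertex_degree E v))"
  have c: "0 \<le> c" by (simp add: c_def)
  let ?B = "\<lambda>h. {\<omega> \<in> space M. T n \<omega> = E \<and> history n \<omega> = h}"
  let ?A = "\<lambda>h. {\<omega> \<in> space M. T n \<omega> = E \<and> V n \<omega> = v \<and> W n \<omega> = w \<and> history n \<omega> = h}"
  have hm: "{\<omega> \<in> space M. history n \<omega> = h} \<in> events" for h
    using measurable_sets[OF history_measurable, of "{h}" n] by (simp add: vimage_def Int_def conj_commute)
  have B: "?B h \<in> events" for h
  proof -
    have "?B h = {\<omega> \<in> space M. T n \<omega> \<in> {E}} \<inter> {\<omega> \<in> space M. history n \<omega> = h}" by auto
    then show ?thesis using sets.Int[OF T_event[OF n, of "{E}"] hm[of h]] by simp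
  qed
  have A: "?A h \<in> events" for h
  proof -
    have "?A h = {\<omega> \<in> space M. T n \<omega> = E \<and> V n \<omega> = v \<and> W n \<omega> = w} \<inter> {\<omega> \<in> space M. history n \<omega> = h}" by auto
    then show ?thesis using sets.Int[OF step_event[OF n, of E v w] hm[of h]] by simp
  qed
  have AB: "emeasure M (?A h) = ennreal c * emeasure M (?B h)" for h
  proof (cases "length h = n - 2")
    case True
    let ?p = "past V W T n E (\<lambda>k. fst (h ! (k - 2))) (\<lambda>k. snd (h ! (k - 2)))"
    have "?B h = {\<omega> \<in> space M. ?p \<omega>}" "?A h = {\<omega> \<in> space M. ?p \<omega> \<and> V n \<omega> = v \<and> W n \<omega> = w}"
      using True by (auto simp: past_def history_eq_iff)
    then have "measure M (?A h) = c * measure M (?B h)"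
      using prob_step_past[OF n v w, of "\<lambda>k. fst (h ! (k - 2))" "\<lambda>k. snd (h ! (k - 2))"]
      by (simp only: c_def) simp
    then show ?thesis unfolding emeasure_eq_measure by (simp only: ennreal_mult'[OF c])
  next
    case False
    then have "?B h = {}" "?A h = {}" by (auto simp: history_eq_iff)
    then show ?thesis by (simp only: emeasure_empty mult_zero_right)
  qed
  have "emeasure M (\<Union>h. ?A h) = (\<integral>\<^sup>+h. emeasure M (?A h) \<partial>count_space UNIV)"
    by (rule emeasure_UN_countable) (use A in \<open>auto simp: disjoint_family_on_def\<close>)
  also have "\<dots> = ennreal c * (\<integral>\<^sup>+h. emeasure M (?B h) \<partial>count_space UNIV)"
    by (simp add: AB nn_integral_cmult)
  also have "(\<integral>\<^sup>+h. emeasure M (?B h) \<partial>count_space UNIV) = emeasure M (\<Union>h. ?B h)"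
    by (rule emeasure_UN_countable[symmetric]) (use B in \<open>auto simp: disjoint_family_on_def\<close>)
  also have "(\<Union>h. ?B h) = {\<omega> \<in> space M. T n \<omega> = E}" by auto
  also have "(\<Union>h. ?A h) = {\<omega> \<in> space M. T n \<omega> = E \<and> V n \<omega> = v \<and> W n \<omega> = w}" by auto
  finally have "ennreal (\<P>(\<omega> in M. T n \<omega> = E \<and> V n \<omega> = v \<and> W n \<omega> = w))
      = ennreal (c * \<P>(\<omega> in M. T n \<omega> = E))"
    unfolding emeasure_eq_measure by (simp only: ennreal_mult'[OF c])
  then have "\<P>(\<omega> in M. T n \<omega> = E \<and> V n \<omega> = v \<and> W n \<omega> = w) = c * \<P>(\<omega> in M. T n \<omega> = E)"
    by (subst (asm) ennreal_inj) (use c in \<open>simp_all add: measure_nonneg\<close>)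
  then show ?thesis by (simp add: c_def)
qed

text \<open>The conditional laws are only known on atoms of positive probability and only for values in the
  support. This gives the inequality \<open>\<ge>\<close> for every event; applied to the complement as well, it is an
  equality because both sides are probabilities.\<close>

lemma prob_T:
  assumes "2 \<le> n"
  shows "\<P>(\<omega> in M. T n \<omega> \<in> A) = measure_pmf.prob (friend_pmf n) A"
  using assms
proof (induction n arbitrary: A rule: dec_induct)
  case base
  have "friend_pmf 2 = return_pmf {{1,2}}" by (simp add: numeral_2_eq_2)
  moreover have "{\<omega> \<in> space M. T 2 \<omega> \<in> A} = (if {{1,2}} \<in> A then space M else {})" using T_2 by auto
  ultimately show ?case by (simp only:) (simp add: prob_space indicator_def)
next
  case (step n)
  note n = step.hyps(1)
  let ?S = "set_pmf (friend_pmf n)"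
  have fin: "finite ?S" and rt: "\<And>E. E \<in> ?S \<Longrightarrow> \<exists>p. rec_tree n E p"
    using friend_pmf_support[OF n] by (auto simp: is_rec_tree_def)
  have ge: "\<P>(\<omega> in M. T (Suc n) \<omega> \<in> A) \<ge> measure_pmf.prob (friend_pmf (Suc n)) A" for A
  proof -
    let ?I = "{(E, v, w). E \<in> ?S \<and> v \<in> {1..n} \<and> w \<in> nbrs E v \<and> insert {w, Suc n} E \<in> A}"
    let ?X = "\<lambda>(E, v, w). {\<omega> \<in> space M. T n \<omega> = E \<and> V n \<omega> = v \<and> W n \<omega> = w}"
    have fn: "finite (nbrs E v)" if "E \<in> ?S" for E v
      using rt[OF that] rec_tree.finite_nbrs_tree by blast
    have I_eq: "?I = (SIGMA E:?S. SIGMA v:{1..n}. {w \<in> nbrs E v. insert {w, Suc n} E \<in> A})" by auto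
    have finI: "finite ?I" unfolding I_eq using fin fn by (intro finite_SigmaI) auto
    have "measure_pmf.prob (friend_pmf (Suc n)) A = measure_pmf.expectation (friend_pmf (Suc n)) (indicator A)"
      by simp
    also have "\<dots> = (\<Sum>E\<in>?S. \<Sum>v\<in>{1..n}. \<Sum>w\<in>nbrs E v. if insert {w, Suc n} E \<in> A then
         \<P>(\<omega> in M. T n \<omega> = E \<and> V n \<omega> = v \<and> W n \<omega> = w) else 0)"
    proof (subst friend_pmf_expectation_Suc[OF n], rule sum.cong[OF refl])
      fix E assume "E \<in> ?S"
      have "pmf (friend_pmf n) E = \<P>(\<omega> in M. T n \<omega> = E)"
        using step.IH[of "{E}"] by (simp add: measure_pmf_single)
      then show "pmf (friend_pmf n) E * friend_avg n E (\<lambda>v w. indicator A (insert {w, Suc n} E)) =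
        (\<Sum>v\<in>{1..n}. \<Sum>w\<in>nbrs E v. if insert {w, Suc n} E \<in> A then
         \<P>(\<omega> in M. T n \<omega> = E \<and> V n \<omega> = v \<and> W n \<omega> = w) else 0)"
        unfolding friend_avg_def sum_distrib_left
        by (intro sum.cong refl) (simp add: prob_step[OF n] indicator_def)
    qed
    also have "\<dots> = (\<Sum>E\<in>?S. \<Sum>v\<in>{1..n}. \<Sum>w\<in>{w\<in>nbrs E v. insert {w, Suc n} E \<in> A}.
         \<P>(\<omega> in M. T n \<omega> = E \<and> V n \<omega> = v \<and> W n \<omega> = w))"
      by (intro sum.cong[OF refl], rule sum.inter_filter[symmetric]) (use fn in blast)
    also have "\<dots> = (\<Sum>i\<in>?I. prob (?X i))"
      unfolding I_eq using fin fn by (simp add: sum.Sigma case_prod_beta' cong: sum.cong)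
    also have "\<dots> = prob (\<Union>i\<in>?I. ?X i)"
      using finI step_event[OF n]
      by (intro finite_measure_finite_Union[symmetric]) (auto simp: disjoint_family_on_def)
    also have "\<dots> \<le> \<P>(\<omega> in M. T (Suc n) \<omega> \<in> A)"
      using n T_Suc[OF n] by (intro finite_measure_mono T_event) auto
    finally show ?thesis .
  qed
  have "\<P>(\<omega> in M. T (Suc n) \<omega> \<in> A) = 1 - \<P>(\<omega> in M. T (Suc n) \<omega> \<in> - A)"
  proof -
    have "{\<omega> \<in> space M. T (Suc n) \<omega> \<in> A} = space M - {\<omega> \<in> space M. T (Suc n) \<omega> \<in> - A}" by auto
    then show ?thesis using prob_compl[OF T_event[of "Suc n" "- A"]] n by simp
  qed
  also have "\<dots> \<le> 1 - measure_pmf.prob (friend_pmf (Suc n)) (- A)"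
    using ge[of "- A"] by simp
  also have "\<dots> = measure_pmf.prob (friend_pmf (Suc n)) A"
    using measure_pmf.prob_compl[of A "friend_pmf (Suc n)"] by (simp add: Compl_eq_Diff_UNIV)
  finally show ?case using ge[of A] by simp
qed

end

section \<open>Distances to the leaves and the upper bound\<close>

abbreviation adj :: "nat set set \<Rightarrow> (nat \<times> nat) set" where
  "adj E \<equiv> {(a, b). {a, b} \<in> E}"

definition leaf_dist :: "nat \<Rightarrow> nat set set \<Rightarrow> nat \<Rightarrow> nat" where
  "leaf_dist n E i = (MIN l\<in>leaves n E. graph_dist E i l)"

lemma graph_dist_le: "(u, v) \<in> adj E ^^ k \<Longrightarrow> graph_dist E u v \<le> k"
  unfolding graph_dist_def by (rule Least_le)

context rec_tree
begin

lemma connected: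
  assumes "u \<in> {1..n}" "v \<in> {1..n}"
  shows "\<exists>k. (u, v) \<in> adj E ^^ k"
proof -
  have "{1..n} \<subseteq> {x. \<exists>k. (u, x) \<in> adj E ^^ k}"
  proof (rule all_vertices_if_closed)
    have "(u, u) \<in> adj E ^^ 0" by simp
    then show "u \<in> {x. \<exists>k. (u, x) \<in> adj E ^^ k}" by blast
  next
    fix x assume "x \<in> {x. \<exists>k. (u, x) \<in> adj E ^^ k}"
    then obtain k where k: "(u, x) \<in> adj E ^^ k" by blast
    have "(u, y) \<in> adj E ^^ Suc k" if "y \<in> nbrs E x" for y
      using k that by (auto simp: nbrs_def intro!: relcompI)
    then show "nbrs E x \<subseteq> {x. \<exists>k. (u, x) \<in> adj E ^^ k}" by blast
  qed (use assms in simp)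
  then show ?thesis using assms by blast
qed

lemma graph_dist_walk:
  assumes "u \<in> {1..n}" "v \<in> {1..n}"
  shows "(u, v) \<in> adj E ^^ graph_dist E u v"
  unfolding graph_dist_def by (rule LeastI_ex[OF connected[OF assms]])

lemma walk_stays:
  assumes "(u, v) \<in> adj E ^^ k" "u \<in> {1..n}"
  shows "v \<in> {1..n}"
  using assms(1)
proof (induction k arbitrary: v)
  case (Suc k)
  then obtain x where "(x, v) \<in> adj E" by auto
  then have "v \<in> nbrs E x" by (simp add: nbrs_def)
  then show ?case using nbrs_subset by blast
qed (use assms(2) in simp)

lemma graph_dist_layer:
  assumes "u \<in> {1..n}" "v \<in> {1..n}" "s \<le> graph_dist E u v"
  shows "\<exists>x\<in>{1..n}. graph_dist E u x = s"
proof -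
  let ?k = "graph_dist E u v"
  have "(u, v) \<in> adj E ^^ (s + (?k - s))"
    using graph_dist_walk[OF assms(1,2)] assms(3) by simp
  then obtain x where x: "(u, x) \<in> adj E ^^ s" "(x, v) \<in> adj E ^^ (?k - s)"
    by (auto simp: relpow_add)
  have xV: "x \<in> {1..n}" using walk_stays[OF x(1) assms(1)] .
  have "(u, v) \<in> adj E ^^ (graph_dist E u x + (?k - s))"
    unfolding relpow_add using graph_dist_walk[OF assms(1) xV] x(2) by blast
  then have "?k \<le> graph_dist E u x + (?k - s)" by (rule graph_dist_le)
  with graph_dist_le[OF x(1)] assms(3) have "graph_dist E u x = s" by linarith
  then show ?thesis using xV by blast
qed

text \<open>A shortest walk from \<open>u\<close> to \<open>v\<close> meets every distance up to \<open>r\<close>.\<close>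

lemma card_ball_ge:
  assumes "u \<in> {1..n}" "v \<in> {1..n}" "r \<le> graph_dist E u v"
  shows "Suc r \<le> card {x \<in> {1..n}. graph_dist E u x \<le> r}"
proof -
  have "\<exists>x. \<forall>s\<le>r. x s \<in> {1..n} \<and> graph_dist E u (x s) = s"
    using graph_dist_layer[OF assms(1,2)] assms(3) by (intro choice) (meson order_trans)
  then obtain x where x: "\<And>s. s \<le> r \<Longrightarrow> x s \<in> {1..n} \<and> graph_dist E u (x s) = s" by blast
  have "inj_on x {..r}" by (rule inj_on_inverseI[of _ "graph_dist E u"]) (use x in auto)
  then have "Suc r = card (x ` {..r})" by (simp add: card_image)
  also have "\<dots> \<le> card {x \<in> {1..n}. graph_dist E u x \<le> r}"
    by (rule card_mono) (use x in auto)
  finally show ?thesis .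
qed

lemma leaf_dist_le: "l \<in> leaves n E \<Longrightarrow> leaf_dist n E i \<le> graph_dist E i l"
  unfolding leaf_dist_def by (intro Min_le) auto

lemma leaf_dist_attained: "\<exists>l\<in>leaves n E. leaf_dist n E i = graph_dist E i l"
proof -
  have "leaf_dist n E i \<in> graph_dist E i ` leaves n E"
    unfolding leaf_dist_def using last_is_leaf by (intro Min_in) auto
  then show ?thesis by auto
qed

lemma leaf_dist_leaf: "l \<in> leaves n E \<Longrightarrow> leaf_dist n E l = 0"
  using leaf_dist_le[of l l] graph_dist_le[where E = E and u = l and v = l and k = 0] by simp

lemma graph_dist_attach_le:
  assumes "u \<in> {1..n}" "v \<in> {1..n}"
  shows "graph_dist (insert {w, Suc n} E) u v \<le> graph_dist E u v"
proof (rule graph_dist_le)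
  have mono: "adj E \<subseteq> adj (insert {w, Suc n} E)" by auto
  have "adj E ^^ k \<subseteq> adj (insert {w, Suc n} E) ^^ k" for k
  proof (induction k)
    case (Suc k)
    then show ?case by (simp only: relpow.simps relcomp_mono[OF _ mono])
  qed simp
  then show "(u, v) \<in> adj (insert {w, Suc n} E) ^^ graph_dist E u v"
    using graph_dist_walk[OF assms] by blast
qed

lemma graph_dist_attach_new:
  assumes "u \<in> {1..n}" "w \<in> {1..n}"
  shows "graph_dist (insert {w, Suc n} E) u (Suc n) \<le> Suc (graph_dist E u w)"
proof -
  interpret E': rec_tree "Suc n" "insert {w, Suc n} E" "p(Suc n := w)"
    by (rule attach[OF assms(2)])
  have "(u, w) \<in> adj (insert {w, Suc n} E) ^^ graph_dist (insert {w, Suc n} E) u w"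
    using assms by (intro E'.graph_dist_walk) auto
  then have "(u, Suc n) \<in> adj (insert {w, Suc n} E) ^^ Suc (graph_dist (insert {w, Suc n} E) u w)"
    by auto
  then show ?thesis using graph_dist_le graph_dist_attach_le[OF assms] by (meson Suc_le_mono order_trans)
qed

text \<open>The new vertex is a leaf next to \<open>w\<close>, and all old leaves except possibly \<open>w\<close> remain leaves.\<close>

lemma leaf_dist_attach:
  assumes i: "i \<in> {1..n}" and w: "w \<in> {1..n}"
  shows leaf_dist_attach_near: "leaf_dist (Suc n) (insert {w, Suc n} E) i \<le> Suc (graph_dist E i w)"
    and leaf_dist_attach_far:
      "l \<in> leaves n E \<Longrightarrow> w \<noteq> l \<Longrightarrow> leaf_dist (Suc n) (insert {w, Suc n} E) i \<le> graph_dist E i l"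
    and leaf_dist_attach_new: "leaf_dist (Suc n) (insert {w, Suc n} E) (Suc n) = 0"
proof -
  interpret E': rec_tree "Suc n" "insert {w, Suc n} E" "p(Suc n := w)"
    by (rule attach[OF w])
  show "leaf_dist (Suc n) (insert {w, Suc n} E) i \<le> Suc (graph_dist E i w)"
    using E'.leaf_dist_le[OF E'.last_is_leaf] graph_dist_attach_new[OF i w] by (rule order_trans)
  show "leaf_dist (Suc n) (insert {w, Suc n} E) (Suc n) = 0"
    by (rule E'.leaf_dist_leaf[OF E'.last_is_leaf])
  assume l: "l \<in> leaves n E" "w \<noteq> l"
  then have "l \<in> leaves (Suc n) (insert {w, Suc n} E)" unfolding leaves_attach[OF w] by auto
  from E'.leaf_dist_le[OF this, of i] graph_dist_attach_le[OF i, of l w] l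
  show "leaf_dist (Suc n) (insert {w, Suc n} E) i \<le> graph_dist E i l"
    by (auto simp: leaves_def)
qed

lemma leaf_attach_prob_le: "l \<in> leaves n E \<Longrightarrow> attach_prob l \<le> 1 / n"
proof -
  assume "l \<in> leaves n E"
  then obtain u where u: "nbrs E l = {u}" "u \<in> {1..n}" using leaf_nbrs by blast
  have "vertex_degree E u \<ge> 1" by (rule degree_pos[OF u(2)])
  then show ?thesis using n_ge_2
    unfolding leaf_attach_prob[OF u(1)] by (intro divide_left_mono) auto
qed

end

text \<open>This is \<open>(j + 7)! / (7! 8^j)\<close>. The growth must be factorial to detect distances of order
  \<open>log n / log log n\<close>, while the factor \<open>1 / 8\<close> keeps an increase of \<open>j\<close> by one cheaper than the gain
  from the frequent collapses.\<close>

primrec growth :: "nat \<Rightarrow> real" where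
  "growth 0 = 1"
| "growth (Suc j) = (1 + real j / 8) * growth j"

lemma growth_ge_1: "growth j \<ge> 1"
proof (induction j)
  case (Suc j)
  have "1 * 1 \<le> (1 + real j / 8) * growth j" by (intro mult_mono Suc) auto
  then show ?case by simp
qed simp

lemma growth_mono: "i \<le> j \<Longrightarrow> growth i \<le> growth j"
proof (rule lift_Suc_mono_le[of growth])
  fix j
  have "1 * growth j \<le> (1 + real j / 8) * growth j" using growth_ge_1[of j] by (intro mult_right_mono) auto
  then show "growth j \<le> growth (Suc j)" by simp
qed

text \<open>All factors with index at least \<open>8 y - 8\<close> are at least \<open>y\<close>, the others at least \<open>1\<close>.\<close>

lemma growth_ge_powr:
  assumes "y \<ge> 1"
  shows "growth j \<ge> y powr (real j - 8 * y)"
proof (induction j)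
  case 0
  have "y powr (real 0 - 8 * y) \<le> y powr 0" using assms by (intro powr_mono) auto
  then show ?case using assms by simp
next
  case (Suc j)
  show ?case
  proof (cases "real j \<ge> 8 * y - 8")
    case True
    have "y powr (real (Suc j) - 8 * y) = y * y powr (real j - 8 * y)"
      using assms by (simp add: powr_add powr_diff)
    also have "\<dots> \<le> (1 + real j / 8) * growth j"
      using True assms Suc by (intro mult_mono) auto
    finally show ?thesis by simp
  next
    case False
    then have "y powr (real (Suc j) - 8 * y) \<le> y powr 0" using assms by (intro powr_mono) auto
    then show ?thesis using assms growth_ge_1[of "Suc j"] by simp
  qed
qed

text \<open>The left-hand side is the price of an increase of the distance \<open>d\<close>, the right-hand side the gain
  from a collapse to at most \<open>d div 2 + 2\<close>, weighted with the number of vertices \<open>V\<close> that cause it.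
  The bound \<open>5 \<le> d\<close> makes \<open>d div 2 + 2 < d\<close>.\<close>

lemma growth_drift:
  assumes "5 \<le> d"
  shows "growth (Suc d) - growth d \<le> real (Suc (d div 2)) * (growth d - growth (d div 2 + 2))"
proof -
  obtain e where e: "d = Suc e" "4 \<le> e" using assms by (cases d) auto
  have "growth (d div 2 + 2) \<le> growth e" using e by (intro growth_mono) auto
  moreover have "growth d = (1 + real e / 8) * growth e" using e by simp
  moreover have "(1 + real e / 8) * growth e \<ge> (3/2) * growth e"
    using e growth_ge_1[of e] by (intro mult_right_mono) auto
  ultimately have *: "growth d - growth (d div 2 + 2) \<ge> growth d / 3" by linarith
  have "growth (Suc d) - growth d = real d / 8 * growth d" by (simp add: algebra_simps)
  also have "\<dots> \<le> (real d / 2) * (growth d / 3)"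
    using growth_ge_1[of d] by (simp add: field_simps)
  also have "\<dots> \<le> real (Suc (d div 2)) * (growth d - growth (d div 2 + 2))"
    using * growth_ge_1[of d] by (intro mult_mono) linarith+
  finally show ?thesis .
qed

context rec_tree
begin

text \<open>The two effects are compared pointwise: attaching to the chosen nearest leaf \<open>l\<close> costs \<open>up\<close>, and
  choosing \<open>V\<close> in the ball \<open>B\<close> of radius \<open>d div 2\<close> gains \<open>down\<close>, whatever \<open>W\<close> is. Below distance \<open>5\<close>
  only the cost is counted, which leaves the error term.\<close>

lemma growth_leaf_dist_step:
  assumes i: "i \<in> {1..n}"
  shows "friend_avg n E (\<lambda>v w. growth (leaf_dist (Suc n) (insert {w, Suc n} E) i))
    \<le> growth (leaf_dist n E i) + growth 5 / n"
proof -
  define d where "d = leaf_dist n E i"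
  obtain l where l: "l \<in> leaves n E" "d = graph_dist E i l"
    unfolding d_def using leaf_dist_attained by blast
  have lV: "l \<in> {1..n}" using l by (simp add: leaves_def)
  let ?\<delta> = "\<lambda>w. leaf_dist (Suc n) (insert {w, Suc n} E) i"
  define up where "up = growth (Suc d) - growth d"
  have up: "up \<ge> 0" unfolding up_def using growth_mono[of d "Suc d"] by linarith
  have near: "?\<delta> w \<le> (if w = l then Suc d else d)" if "w \<in> {1..n}" for w
    using leaf_dist_attach_near[OF i that] leaf_dist_attach_far[OF i that l(1)] l(2) by auto
  have avg_up: "friend_avg n E (\<lambda>v w. if w = l then up else 0) \<le> up / n"
  proof -
    have "friend_avg n E (\<lambda>v w. if w = l then up else 0) = up * attach_prob l"
    proof -
      have "(\<Sum>w\<in>{1..n}. (if w = l then up else 0) * attach_prob w) =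
          (\<Sum>w\<in>{1..n}. if w = l then up * attach_prob w else 0)"
        by (intro sum.cong) auto
      then show ?thesis unfolding friend_avg_snd using lV by simp
    qed
    then show ?thesis using mult_left_mono[OF leaf_attach_prob_le[OF l(1)] up] by simp
  qed
  show ?thesis
  proof (cases "5 \<le> d")
    case False
    have "friend_avg n E (\<lambda>v w. growth (?\<delta> w)) \<le> friend_avg n E (\<lambda>v w. growth d + (if w = l then up else 0))"
    proof (rule friend_avg_mono)
      fix v w assume "w \<in> nbrs E v"
      then have "w \<in> {1..n}" using nbrs_subset by blast
      then show "growth (?\<delta> w) \<le> growth d + (if w = l then up else 0)"
        using growth_mono[OF near[of w]] by (auto simp: up_def)
    qed
    also have "\<dots> \<le> growth d + up / n" using avg_up by (simp add: friend_avg_add friend_avg_const)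
    also have "\<dots> \<le> growth d + growth 5 / n"
      using growth_mono[of "Suc d" 5] growth_ge_1[of d] False n_ge_2 unfolding up_def
      by (intro add_left_mono divide_right_mono) auto
    finally show ?thesis by (simp add: d_def)
  next
    case True
    define r where "r = d div 2"
    define B where "B = {x \<in> {1..n}. graph_dist E i x \<le> r}"
    define down where "down = growth d - growth (r + 2)"
    have r: "r + 2 \<le> d" "r \<le> graph_dist E i l" using True l(2) by (auto simp: r_def)
    have down: "down \<ge> 0" unfolding down_def using growth_mono[OF r(1)] by linarith
    have card: "Suc r \<le> card B" unfolding B_def by (rule card_ball_ge[OF i lV r(2)])
    have "friend_avg n E (\<lambda>v w. growth (?\<delta> w)) \<le>
      friend_avg n E (\<lambda>v w. (growth d + (if w = l then up else 0)) - (if v \<in> B then down else 0))"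
    proof (rule friend_avg_mono)
      fix v w assume v: "v \<in> {1..n}" and w: "w \<in> nbrs E v"
      then have wV: "w \<in> {1..n}" using nbrs_subset by blast
      show "growth (?\<delta> w) \<le> (growth d + (if w = l then up else 0)) - (if v \<in> B then down else 0)"
      proof (cases "v \<in> B")
        case True
        have "(i, w) \<in> adj E ^^ Suc (graph_dist E i v)"
          using graph_dist_walk[OF i v] w by (auto simp: nbrs_def intro!: relcompI)
        then have "graph_dist E i w \<le> Suc r" using graph_dist_le True unfolding B_def by fastforce
        then have "?\<delta> w \<le> r + 2" using leaf_dist_attach_near[OF i wV] by linarith
        then have "growth (?\<delta> w) \<le> growth (r + 2)" by (rule growth_mono)
        then show ?thesis using True up unfolding down_def by (cases "w = l") (simp_all del: growth.simps)
      next
        case False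
        then show ?thesis using growth_mono[OF near[OF wV]] by (auto simp: up_def)
      qed
    qed
    also have "\<dots> = growth d + friend_avg n E (\<lambda>v w. if w = l then up else 0)
        - friend_avg n E (\<lambda>v w. if v \<in> B then down else 0)"
      by (simp only: friend_avg_add friend_avg_diff friend_avg_const)
    also have "friend_avg n E (\<lambda>v w. if v \<in> B then down else 0) = card B * down / n"
    proof -
      have "B \<subseteq> {1..n}" by (auto simp: B_def)
      then have "(\<Sum>v\<in>{1..n}. if v \<in> B then down else 0) = card B * down"
        by (subst sum.inter_restrict[symmetric]) (auto simp: Int_absorb1)
      then show ?thesis by (simp only: friend_avg_fst)
    qed
    also have "growth d + friend_avg n E (\<lambda>v w. if w = l then up else 0) - card B * down / n
        \<le> growth d + up / n - Suc r * down / n"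
      using avg_up card down by (intro diff_mono add_left_mono divide_right_mono mult_right_mono) auto
    also have "\<dots> \<le> growth d"
      using growth_drift[OF True] divide_right_mono[of up "Suc r * down" n]
      unfolding up_def down_def r_def by simp
    also have "\<dots> \<le> growth d + growth 5 / n" using growth_ge_1[of 5] by simp
    finally show ?thesis by (simp add: d_def)
  qed
qed

end

definition leaf_potential :: "nat \<Rightarrow> nat set set \<Rightarrow> real" where
  "leaf_potential n E = (\<Sum>i\<in>{1..n}. growth (leaf_dist n E i))"

lemma (in rec_tree) leaf_potential_step:
  "friend_avg n E (\<lambda>v w. leaf_potential (Suc n) (insert {w, Suc n} E)) \<le> leaf_potential n E + (growth 5 + 1)"
proof -
  have "friend_avg n E (\<lambda>v w. leaf_potential (Suc n) (insert {w, Suc n} E)) \<le>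
    friend_avg n E (\<lambda>v w. (\<Sum>i\<in>{1..n}. growth (leaf_dist (Suc n) (insert {w, Suc n} E) i)) + 1)"
  proof (rule friend_avg_mono)
    fix v w assume "w \<in> nbrs E v"
    then have "w \<in> {1..n}" using nbrs_subset by blast
    then show "leaf_potential (Suc n) (insert {w, Suc n} E) \<le> (\<Sum>i\<in>{1..n}. growth (leaf_dist (Suc n) (insert {w, Suc n} E) i)) + 1"
      using leaf_dist_attach_new[of w w] by (simp add: leaf_potential_def)
  qed
  also have "\<dots> = (\<Sum>i\<in>{1..n}. friend_avg n E (\<lambda>v w. growth (leaf_dist (Suc n) (insert {w, Suc n} E) i))) + 1"
    by (simp only: friend_avg_add friend_avg_sum friend_avg_const)
  also have "\<dots> \<le> (\<Sum>i\<in>{1..n}. growth (leaf_dist n E i) + growth 5 / n) + 1"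
    by (intro add_right_mono sum_mono growth_leaf_dist_step)
  also have "\<dots> = leaf_potential n E + (growth 5 + 1)"
    using n_ge_2 by (simp add: leaf_potential_def sum.distrib)
  finally show ?thesis .
qed

lemma leaf_potential_linear:
  obtains K :: real where "K > 0" "\<And>n. 2 \<le> n \<Longrightarrow> measure_pmf.expectation (friend_pmf n) (leaf_potential n) \<le> K * n"
proof
  define K where "K = \<bar>measure_pmf.expectation (friend_pmf 2) (leaf_potential 2)\<bar> + (growth 5 + 1)"
  show "K > 0" using growth_ge_1[of 5] by (simp add: K_def)
  fix n :: nat assume "2 \<le> n"
  then show "measure_pmf.expectation (friend_pmf n) (leaf_potential n) \<le> K * n"
  proof (induction n rule: dec_induct)
    case base
    show ?case using growth_ge_1[of 5] unfolding K_def by (simp del: growth.simps)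
  next
    case (step n)
    have "measure_pmf.expectation (friend_pmf (Suc n)) (leaf_potential (Suc n)) \<le>
      1 * measure_pmf.expectation (friend_pmf n) (leaf_potential n) + (growth 5 + 1)"
      by (rule friend_pmf_expectation_le[OF step(1)]) (simp add: rec_tree.leaf_potential_step)
    also have "\<dots> \<le> K * n + K" using step.IH unfolding K_def by linarith
    finally show ?case by (simp add: algebra_simps)
  qed
qed

lemma max_leaf_dist_eq: "max_leaf_dist n E = (MAX i\<in>{1..n}. leaf_dist n E i)"
  by (simp add: max_leaf_dist_def leaf_dist_def)

lemma (in rec_tree) max_leaf_dist_attained: "\<exists>i\<in>{1..n}. max_leaf_dist n E = leaf_dist n E i"
proof -
  have "max_leaf_dist n E \<in> leaf_dist n E ` {1..n}"
    unfolding max_leaf_dist_eq using n_ge_2 by (intro Max_in) auto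
  then show ?thesis by auto
qed

lemma (in rec_tree) growth_max_leaf_dist_le: "growth (max_leaf_dist n E) \<le> leaf_potential n E"
proof -
  obtain i where i: "i \<in> {1..n}" "max_leaf_dist n E = leaf_dist n E i" using max_leaf_dist_attained by blast
  have "growth (leaf_dist n E i) \<le> leaf_potential n E"
    unfolding leaf_potential_def using i growth_ge_1
    by (intro member_le_sum) (auto intro: order_trans[OF zero_le_one])
  then show ?thesis using i by simp
qed

lemma max_leaf_dist_upper_tendsto:
  "(\<lambda>n. measure_pmf.prob (friend_pmf n) {E. real (max_leaf_dist n E) > 8 * (ln (real n) / ln (ln (real n)))}) \<longlonglongrightarrow> 0"
proof -
  obtain K :: real where K: "K > 0" "\<And>n. 2 \<le> n \<Longrightarrow> measure_pmf.expectation (friend_pmf n) (leaf_potential n) \<le> K * n"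
    using leaf_potential_linear by blast
  \<comment> \<open>The base \<open>y\<close> tends to infinity fast enough for \<open>y powr (8 log n / log log n)\<close> to be \<open>n\<^sup>4\<close>, and slowly
  enough for the correction \<open>y powr (- 8 y)\<close> to be only \<open>n\<close> to the power \<open>- o(1)\<close>.\<close>
  define y where "y n = sqrt (ln (real n))" for n
  define z where "z n = exp (4 * ln (real n) - 4 * sqrt (ln (real n)) * ln (ln (real n)))" for n :: nat
  have z_eq: "z n = y n powr (8 * (ln (real n) / ln (ln (real n))) - 8 * y n)" if "sqrt (ln (real n)) \<ge> 1" "ln (ln (real n)) > 0" for n
  proof -
    have "y n > 0" "ln (real n) > 0" using that by (auto simp: y_def)
    then show ?thesis using that
      by (simp add: z_def powr_def y_def ln_sqrt field_simps)
  qed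
  have lim: "(\<lambda>n. K * real n / z n) \<longlonglongrightarrow> 0"
    using K(1) unfolding z_def by real_asymp
  have bound: "\<forall>\<^sub>F n in sequentially. measure_pmf.prob (friend_pmf n)
     {E. real (max_leaf_dist n E) > 8 * (ln (real n) / ln (ln (real n)))} \<le> K * real n / z n"
  proof -
    have ev: "\<forall>\<^sub>F n::nat in sequentially. sqrt (ln (real n)) \<ge> 1" "\<forall>\<^sub>F n::nat in sequentially. ln (ln (real n)) > 0"
      by real_asymp+
    show ?thesis using ev(1) eventually_ge_at_top[of 2] ev(2)
    proof eventually_elim
      case (elim n)
      have z: "z n > 0" by (simp add: z_def)
      have "measure_pmf.prob (friend_pmf n) {E. real (max_leaf_dist n E) > 8 * (ln (real n) / ln (ln (real n)))}
        \<le> measure_pmf.expectation (friend_pmf n) (leaf_potential n) / z n"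
      proof (rule friend_pmf_Markov[OF elim(2) z])
        fix E p assume "rec_tree n E p"
        then interpret rec_tree n E p .
        show "0 \<le> leaf_potential n E" using growth_max_leaf_dist_le growth_ge_1[of "max_leaf_dist n E"] by linarith
        assume "E \<in> {E. real (max_leaf_dist n E) > 8 * (ln (real n) / ln (ln (real n)))}"
        then have "z n \<le> y n powr (real (max_leaf_dist n E) - 8 * y n)"
          unfolding z_eq[OF elim(1,3)] using elim by (intro powr_mono) (auto simp: y_def)
        also have "\<dots> \<le> growth (max_leaf_dist n E)" using elim by (intro growth_ge_powr) (simp add: y_def)
        also have "\<dots> \<le> leaf_potential n E" by (rule growth_max_leaf_dist_le)
        finally show "z n \<le> leaf_potential n E" .
      qed
      also have "\<dots> \<le> K * n / z n" using K(2)[OF elim(2)] z by (intro divide_right_mono) auto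
      finally show ?case .
    qed
  qed
  show ?thesis
    by (rule tendsto_sandwich[OF _ bound tendsto_const lim]) simp
qed

section \<open>The rate at which leaves are extended\<close>

text \<open>By \<open>leaf_attach_prob\<close>, \<open>leaf_rate n E / n\<close> is the probability that \<open>W\<close> is a leaf.\<close>

definition leaf_rate :: "nat \<Rightarrow> nat set set \<Rightarrow> real" where
  "leaf_rate n E = (\<Sum>l\<in>leaves n E. \<Sum>u\<in>nbrs E l. 1 / real (vertex_degree E u))"

definition leaf_count :: "nat \<Rightarrow> nat set set \<Rightarrow> nat \<Rightarrow> nat" where
  "leaf_count n E v = card (nbrs E v \<inter> leaves n E)"

context rec_tree
begin

lemma sum_leaf_nbrs:
  "(\<Sum>l\<in>leaves n E. \<Sum>u\<in>nbrs E l. f u) = (\<Sum>v\<in>{1..n}. real (leaf_count n E v) * f v)"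
proof -
  have eq: "nbrs E l = {v \<in> {1..n}. l \<in> nbrs E v}" for l
    using nbrs_subset[of l] nbrs_sym by blast
  then have "(\<Sum>l\<in>leaves n E. \<Sum>u\<in>nbrs E l. f u) = (\<Sum>l\<in>leaves n E. \<Sum>u\<in>{v \<in> {1..n}. l \<in> nbrs E v}. f u)"
    by (intro sum.cong eq refl)
  also have "\<dots> = (\<Sum>v\<in>{1..n}. \<Sum>l\<in>{l \<in> leaves n E. l \<in> nbrs E v}. f v)"
    by (rule sum.swap_restrict) auto
  also have "\<dots> = (\<Sum>v\<in>{1..n}. real (leaf_count n E v) * f v)"
    by (intro sum.cong refl) (simp add: leaf_count_def Int_def conj_commute)
  finally show ?thesis .
qed

lemma leaf_rate_eq: "leaf_rate n E = (\<Sum>v\<in>{1..n}. leaf_count n E v / vertex_degree E v)"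
  unfolding leaf_rate_def sum_leaf_nbrs by simp

lemma leaf_count_le: "leaf_count n E v \<le> vertex_degree E v"
  unfolding leaf_count_def vertex_degree_def by (rule card_mono) auto

lemma leaf_nbr_degree:
  assumes "3 \<le> n" "l \<in> leaves n E" "u \<in> nbrs E l"
  shows "vertex_degree E u \<ge> 2"
proof (rule ccontr)
  assume "\<not> ?thesis"
  moreover have "u \<in> {1..n}" using assms(3) nbrs_subset by blast
  ultimately have "vertex_degree E u = 1" using degree_pos[of u] by linarith
  then have "nbrs E u = {l}" using assms(3) nbrs_sym[of u l]
    by (auto simp: vertex_degree_def card_1_singleton_iff)
  moreover have "nbrs E l = {u}" using leaf_nbrs[OF assms(2)] assms(3) by auto
  ultimately have "{1..n} \<subseteq> {l, u}"
    using assms(2) by (intro all_vertices_if_closed[of l]) (auto simp: leaves_def)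
  then have "card {1..n} \<le> card {l, u}" by (intro card_mono) auto
  also have "\<dots> \<le> 2" by (rule order_trans[OF card_insert_le_m1]) auto
  finally show False using assms(1) by simp
qed

lemma leaf_count_leaf: "3 \<le> n \<Longrightarrow> l \<in> leaves n E \<Longrightarrow> leaf_count n E l = 0"
  using leaf_nbr_degree[of l] by (fastforce simp: leaf_count_def leaves_def)

lemma leaf_count_degree_2:
  assumes n: "4 \<le> n" and v: "v \<in> {1..n}" "vertex_degree E v = 2"
  shows "leaf_count n E v \<le> 1"
proof (rule ccontr)
  assume "\<not> ?thesis"
  then have "card (nbrs E v) \<le> card (nbrs E v \<inter> leaves n E)" using v by (simp add: leaf_count_def vertex_degree_def)
  then have "nbrs E v \<inter> leaves n E = nbrs E v" by (intro card_seteq) auto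
  then have sub: "nbrs E v \<subseteq> leaves n E" by blast
  have "nbrs E u = {v}" if "u \<in> nbrs E v" for u
  proof -
    have "u \<in> leaves n E" "v \<in> nbrs E u" using that sub nbrs_sym by blast+
    then show ?thesis using leaf_nbrs by fastforce
  qed
  then have "{1..n} \<subseteq> insert v (nbrs E v)"
    using v by (intro all_vertices_if_closed[of v]) auto
  then have "card {1..n} \<le> card (insert v (nbrs E v))" by (intro card_mono) auto
  also have "\<dots> \<le> Suc 2" using v(2) card_insert_le_m1[of 3 "nbrs E v" v] by (simp add: vertex_degree_def)
  finally show False using n by simp
qed

text \<open>A lower bound for the increase of \<open>leaf_rate\<close> when the new vertex is attached to \<open>w\<close>. If \<open>w\<close> is a
  leaf at \<open>u\<close>, then \<open>u\<close> loses a leaf and \<open>w\<close> becomes a vertex of degree two with one leaf; otherwise the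
  proportion of leaves among the neighbours of \<open>w\<close> changes from \<open>c / d\<close> to \<open>(c + 1) / (d + 1)\<close>.\<close>

definition rate_gain :: "nat \<Rightarrow> real" where
  "rate_gain w = (if w \<in> leaves n E then (\<Sum>u\<in>nbrs E w. 1/2 - 1 / real (vertex_degree E u))
     else (real (vertex_degree E w) - real (leaf_count n E w)) / (real (vertex_degree E w) * (real (vertex_degree E w) + 1)))"

lemma rate_gain_bounds:
  assumes "3 \<le> n" "w \<in> {1..n}"
  shows "0 \<le> rate_gain w" "rate_gain w \<le> 1"
proof -
  have "0 \<le> rate_gain w \<and> rate_gain w \<le> 1"
  proof (cases "w \<in> leaves n E")
    case True
    then obtain u where u: "nbrs E w = {u}" using leaf_nbrs by blast
    then have "vertex_degree E u \<ge> 2" using leaf_nbr_degree[OF assms(1) True] by simp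
    then show ?thesis using True u by (simp add: rate_gain_def field_simps)
  next
    case False
    define d c where "d = real (vertex_degree E w)" and "c = real (leaf_count n E w)"
    have d: "d \<ge> 1" "0 \<le> c" "c \<le> d" using degree_pos[OF assms(2)] leaf_count_le[of w] by (auto simp: d_def c_def)
    have "d - c \<le> d * (d + 1)" using d mult_mono[of 1 d 1 d] by (simp add: algebra_simps)
    then show ?thesis using False d unfolding rate_gain_def d_def[symmetric] c_def[symmetric] by simp
  qed
  then show "0 \<le> rate_gain w" "rate_gain w \<le> 1" by auto
qed

text \<open>In the sum over all vertices \<open>v\<close> of the proportion of leaves among the neighbours of \<open>v\<close>, only the
  terms for \<open>w\<close> and, if \<open>w\<close> is a leaf, for its neighbour change.\<close>

lemma leaf_rate_attach:
  assumes n: "3 \<le> n" and w: "w \<in> {1..n}"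
  shows "leaf_rate (Suc n) (insert {w, Suc n} E) \<ge> leaf_rate n E + rate_gain w"
proof -
  let ?E = "insert {w, Suc n} E"
  interpret E': rec_tree "Suc n" ?E "p(Suc n := w)"
    by (rule attach[OF w])
  let ?q = "\<lambda>v. leaf_count (Suc n) ?E v / vertex_degree ?E v"
  have new: "Suc n \<notin> nbrs E v" "Suc n \<notin> leaves n E" for v using nbrs_subset[of v] by (auto simp: leaves_def)
  have "(\<Sum>v\<in>{1..n}. ?q v) = leaf_rate n E + rate_gain w"
  proof (cases "w \<in> leaves n E")
    case False
    have L: "leaves (Suc n) ?E = insert (Suc n) (leaves n E)"
      unfolding leaves_attach[OF w] using False by auto
    have "?q v = leaf_count n E v / vertex_degree E v + (if v = w then rate_gain w else 0)" if v: "v \<in> {1..n}" for v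
    proof (cases "v = w")
      case True
      have "nbrs ?E w \<inter> leaves (Suc n) ?E = insert (Suc n) (nbrs E w \<inter> leaves n E)"
        unfolding nbrs_attach[OF w] L by auto
      then have "leaf_count (Suc n) ?E w = Suc (leaf_count n E w)" using new by (simp add: leaf_count_def)
      moreover have frac: "(c + 1) / (d + 1) = c / d + (d - c) / (d * (d + 1))" if "d \<ge> 1" for c d :: real
      proof -
        have "d \<noteq> 0" "d + 1 \<noteq> 0" using that by auto
        then show ?thesis by (simp add: divide_simps) (simp add: algebra_simps)
      qed
      ultimately show ?thesis
        using True False degree_pos[OF w] frac[of "real (vertex_degree E w)" "real (leaf_count n E w)"]
        by (simp add: degree_attach[OF w] rate_gain_def add.commute)
    next
      case False
      have "nbrs ?E v \<inter> leaves (Suc n) ?E = nbrs E v \<inter> leaves n E"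
        unfolding nbrs_attach[OF w] L using new v False by auto
      then show ?thesis using False v by (simp add: leaf_count_def degree_attach[OF w])
    qed
    then have "(\<Sum>v\<in>{1..n}. ?q v) = (\<Sum>v\<in>{1..n}. leaf_count n E v / vertex_degree E v + (if v = w then rate_gain w else 0))"
      by (intro sum.cong) auto
    also have "\<dots> = leaf_rate n E + rate_gain w" using w by (simp add: leaf_rate_eq sum.distrib)
    finally show ?thesis .
  next
    case True
    then obtain u where u: "u \<in> {1..n}" "nbrs E w = {u}" using leaf_nbrs by blast
    then have d2: "vertex_degree E u \<ge> 2" using leaf_nbr_degree[OF n True] by simp
    have uw: "u \<noteq> w" using u not_self_nbr[of w] by auto
    have wu: "w \<in> nbrs E u" using u nbrs_sym by blast
    have u_nl: "u \<notin> leaves n E" using d2 by (auto simp: leaves_def)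
    note L = leaves_attach[OF w]
    have "?q v = leaf_count n E v / vertex_degree E v + ((if v = w then 1/2 else 0) - (if v = u then 1 / vertex_degree E u else 0))"
      if v: "v \<in> {1..n}" for v
    proof -
      consider "v = w" | "v = u" | "v \<noteq> w" "v \<noteq> u" by blast
      then show ?thesis
      proof cases
        case 1
        have "nbrs ?E w \<inter> leaves (Suc n) ?E = {Suc n}"
          unfolding nbrs_attach[OF w] L using u u_nl by auto
        then have "leaf_count (Suc n) ?E w = 1" by (simp add: leaf_count_def)
        moreover have "vertex_degree E w = 1" using True by (simp add: leaves_def)
        ultimately show ?thesis using 1 uw leaf_count_leaf[OF n True]
          by (simp add: degree_attach[OF w])
      next
        case 2
        have "nbrs ?E u \<inter> leaves (Suc n) ?E = (nbrs E u \<inter> leaves n E) - {w}"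
          unfolding nbrs_attach[OF w] L using u uw new by auto
        then have "leaf_count (Suc n) ?E u = leaf_count n E u - 1" using wu True by (simp add: leaf_count_def)
        moreover have "leaf_count n E u \<ge> 1"
          using wu True by (auto simp: leaf_count_def Suc_le_eq card_gt_0_iff)
        ultimately show ?thesis using 2 uw u by (simp add: degree_attach[OF w] of_nat_diff diff_divide_distrib)
      next
        case 3
        have "w \<notin> nbrs E v" using 3 u nbrs_sym by blast
        then have "nbrs ?E v \<inter> leaves (Suc n) ?E = nbrs E v \<inter> leaves n E"
          unfolding nbrs_attach[OF w] L using new v 3 by auto
        then show ?thesis using 3 v by (simp add: leaf_count_def degree_attach[OF w])
      qed
    qed
    then have "(\<Sum>v\<in>{1..n}. ?q v) = (\<Sum>v\<in>{1..n}. leaf_count n E v / vertex_degree E v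
        + ((if v = w then 1/2 else 0) - (if v = u then 1 / vertex_degree E u else 0)))"
      by (intro sum.cong) auto
    also have "\<dots> = leaf_rate n E + rate_gain w"
      using w u True by (simp add: leaf_rate_eq sum.distrib sum_subtractf rate_gain_def)
    finally show ?thesis .
  qed
  moreover have "leaf_rate (Suc n) ?E = (\<Sum>v\<in>{1..n}. ?q v) + ?q (Suc n)"
    unfolding E'.leaf_rate_eq by simp
  ultimately show ?thesis by simp
qed

text \<open>All children of the largest vertex \<open>v\<close> that is not a leaf are leaves, so at least half of the
  neighbours of \<open>v\<close> are.\<close>

lemma leaf_rate_ge_half:
  assumes n: "3 \<le> n"
  shows "leaf_rate n E \<ge> 1/2"
proof -
  let ?I = "{v \<in> {1..n}. vertex_degree E v \<ge> 2}"
  obtain u where u: "u \<in> {1..n}" "nbrs E n = {u}" using leaf_nbrs[OF last_is_leaf] by blast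
  then have "u \<in> ?I" using leaf_nbr_degree[OF n last_is_leaf] by simp
  then have ne: "?I \<noteq> {}" by blast
  define v where "v = Max ?I"
  have v: "v \<in> ?I" unfolding v_def using ne by (intro Max_in) auto
  have "nbrs E v - {p v} \<subseteq> nbrs E v \<inter> leaves n E"
  proof
    fix x assume x: "x \<in> nbrs E v - {p v}"
    then have "x \<in> {2..n}" "p x = v" by (auto simp: nbrs_eq split: if_splits)
    then have "v < x" "x \<in> {1..n}" using parent[of x] by auto
    have "x \<notin> ?I"
    proof
      assume "x \<in> ?I"
      then have "x \<le> v" unfolding v_def by (intro Max_ge) auto
      with \<open>v < x\<close> show False by simp
    qed
    then have "vertex_degree E x = 1" using degree_pos[of x] \<open>x \<in> {1..n}\<close> by fastforce
    then show "x \<in> nbrs E v \<inter> leaves n E" using x \<open>x \<in> {1..n}\<close> by (auto simp: leaves_def)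
  qed
  then have "card (nbrs E v - {p v}) \<le> leaf_count n E v" unfolding leaf_count_def by (intro card_mono) auto
  moreover have "card (nbrs E v - {p v}) \<ge> vertex_degree E v - 1"
    by (simp add: vertex_degree_def card_Diff_singleton_if)
  ultimately have "real (vertex_degree E v) \<le> 2 * real (leaf_count n E v)" using v by auto
  then have "1/2 \<le> leaf_count n E v / vertex_degree E v" using v by (simp add: field_simps)
  also have "\<dots> \<le> leaf_rate n E" unfolding leaf_rate_eq
    using v by (intro member_le_sum) auto
  finally show ?thesis .
qed

text \<open>Sort the gains by the vertex \<open>v\<close> whose leaves are involved, \<open>d\<close> being its degree and \<open>c\<close> its number
  of leaves. The leaves of \<open>v\<close> are extended with total probability \<open>c / (d n)\<close>, and each of them, when
  it is \<open>V\<close>, makes \<open>v\<close> receive a new leaf. Together this gives at least \<open>c / (d n)\<close> times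
  \<open>(1/2 - 1/d) + (d - c) / (d + 1)\<close>. For \<open>d \<ge> 3\<close> the first summand suffices; for \<open>d = 2\<close> it vanishes,
  but then \<open>v\<close> has at most one leaf and the second summand is \<open>1/3\<close>.\<close>

lemma rate_gain_avg:
  assumes n: "4 \<le> n"
  shows "friend_avg n E (\<lambda>v w. rate_gain w) \<ge> leaf_rate n E / (6 * n)"
proof -
  have n3: "3 \<le> n" using n by simp
  define c where "c v = real (leaf_count n E v)" for v
  define d where "d v = real (vertex_degree E v)" for v
  have L: "leaves n E \<subseteq> {1..n}" by (auto simp: leaves_def)
  have c0: "c v = 0" if "v \<in> leaves n E" for v using leaf_count_leaf[OF n3 that] by (simp add: c_def)
  have leaf: "(\<Sum>w\<in>leaves n E. rate_gain w * attach_prob w)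
      = (\<Sum>v\<in>{1..n}. c v * ((1/2 - 1 / d v) / (n * d v)))"
  proof -
    have "(\<Sum>w\<in>leaves n E. rate_gain w * attach_prob w) = (\<Sum>w\<in>leaves n E. \<Sum>u\<in>nbrs E w. (1/2 - 1 / d u) / (n * d u))"
    proof (intro sum.cong refl)
      fix w assume w: "w \<in> leaves n E"
      then obtain u where u: "nbrs E w = {u}" using leaf_nbrs by blast
      show "rate_gain w * attach_prob w = (\<Sum>u\<in>nbrs E w. (1/2 - 1 / d u) / (n * d u))"
        using w by (simp add: u rate_gain_def leaf_attach_prob[OF u] d_def)
    qed
    then show ?thesis unfolding sum_leaf_nbrs c_def by simp
  qed
  have "(\<Sum>v\<in>{1..n}. c v * ((d v - c v) / (d v * (d v + 1))) / n)
     = (\<Sum>v\<in>{1..n} - leaves n E. c v * ((d v - c v) / (d v * (d v + 1))) / n)"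
    by (rule sum.mono_neutral_right) (use c0 in auto)
  also have "\<dots> \<le> (\<Sum>w\<in>{1..n} - leaves n E. rate_gain w * attach_prob w)"
  proof (rule sum_mono)
    fix w assume w: "w \<in> {1..n} - leaves n E"
    have "(\<Sum>v\<in>nbrs E w \<inter> leaves n E. 1 / (real n * real (vertex_degree E v))) \<le> attach_prob w"
      unfolding attach_prob_def by (rule sum_mono2) auto
    moreover have "(\<Sum>v\<in>nbrs E w \<inter> leaves n E. 1 / (real n * real (vertex_degree E v))) = c w / n"
      by (subst sum.cong[OF refl, of _ _ "\<lambda>_. 1 / real n"]) (auto simp: leaves_def c_def leaf_count_def)
    ultimately have "c w / n \<le> attach_prob w" by simp
    then have "rate_gain w * (c w / n) \<le> rate_gain w * attach_prob w"
      using rate_gain_bounds[OF n3] w by (intro mult_left_mono) auto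
    then show "c w * ((d w - c w) / (d w * (d w + 1))) / n \<le> rate_gain w * attach_prob w"
      using w by (simp add: rate_gain_def c_def d_def mult.commute)
  qed
  finally have nonleaf: "(\<Sum>v\<in>{1..n}. c v * ((d v - c v) / (d v * (d v + 1))) / n)
      \<le> (\<Sum>w\<in>{1..n} - leaves n E. rate_gain w * attach_prob w)" .
  have "leaf_rate n E / (6 * n) = (\<Sum>v\<in>{1..n}. c v / d v / (6 * n))"
    by (simp add: leaf_rate_eq sum_divide_distrib c_def d_def)
  also have "\<dots> \<le> (\<Sum>v\<in>{1..n}. c v * ((1/2 - 1 / d v) / (n * d v)) + c v * ((d v - c v) / (d v * (d v + 1))) / n)"
  proof (rule sum_mono)
    fix v assume v: "v \<in> {1..n}"
    have "c v / d v / n * (1/6) \<le> c v / d v / n * ((1/2 - 1 / d v) + (d v - c v) / (d v + 1))"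
    proof (cases "leaf_count n E v = 0")
      case False
      then have "v \<notin> leaves n E" using leaf_count_leaf[OF n3, of v] by metis
      then have d: "vertex_degree E v \<ge> 2" using degree_pos[OF v] v by (simp add: leaves_def)
      have cd: "c v \<le> d v" "d v \<ge> 2" using leaf_count_le[of v] d by (auto simp: c_def d_def)
      have "1/6 \<le> (1/2 - 1 / d v) + (d v - c v) / (d v + 1)"
      proof (cases "vertex_degree E v = 2")
        case True
        then have "c v \<le> 1" "d v = 2" using leaf_count_degree_2[OF n v True] by (auto simp: c_def d_def)
        then show ?thesis by (simp add: field_simps)
      next
        case False
        then have "d v \<ge> 3" using d by (simp add: d_def)
        then have "1 / d v \<le> 1 / 3" by (simp add: field_simps)
        moreover have "0 \<le> (d v - c v) / (d v + 1)" using cd by simp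
        ultimately show ?thesis by linarith
      qed
      then show ?thesis using cd by (intro mult_left_mono) (auto simp: c_def)
    qed (simp add: c_def)
    also have "\<dots> = c v * ((1/2 - 1 / d v) / (n * d v)) + c v * ((d v - c v) / (d v * (d v + 1))) / n"
    proof -
      have e1: "c v * ((1/2 - 1 / d v) / (n * d v)) = c v / d v / n * (1/2 - 1 / d v)" by simp
      have e2: "c v * ((d v - c v) / (d v * (d v + 1))) / n = c v / d v / n * ((d v - c v) / (d v + 1))" by simp
      show ?thesis unfolding e1 e2 by (rule distrib_left)
    qed
    finally show "c v / d v / (6 * n) \<le> c v * ((1/2 - 1 / d v) / (n * d v)) + c v * ((d v - c v) / (d v * (d v + 1))) / n"
      by (simp add: mult_ac)
  qed
  also have "\<dots> \<le> (\<Sum>w\<in>leaves n E. rate_gain w * attach_prob w) + (\<Sum>w\<in>{1..n} - leaves n E. rate_gain w * attach_prob w)"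
    unfolding sum.distrib leaf using nonleaf by (rule add_left_mono)
  also have "\<dots> = friend_avg n E (\<lambda>v w. rate_gain w)"
    unfolding friend_avg_snd using sum.subset_diff[OF L, of "\<lambda>w. rate_gain w * attach_prob w"] by simp
  finally show ?thesis .
qed

text \<open>Since the gain is at most \<open>1\<close> and \<open>h \<ge> 1/2\<close>, one has \<open>h + g \<le> 3 h\<close>; this turns
  \<open>1/(h + g)\<close> into a function that is linear in the gain.\<close>

lemma inverse_leaf_rate_step:
  assumes n: "4 \<le> n"
  shows "friend_avg n E (\<lambda>v w. 1 / leaf_rate (Suc n) (insert {w, Suc n} E)) \<le> (1 - 1 / (18 * n)) * (1 / leaf_rate n E)"
proof -
  have n3: "3 \<le> n" using n by simp
  define h where "h = leaf_rate n E"
  have h: "h \<ge> 1/2" unfolding h_def by (rule leaf_rate_ge_half[OF n3])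
  have "friend_avg n E (\<lambda>v w. 1 / leaf_rate (Suc n) (insert {w, Suc n} E)) \<le>
    friend_avg n E (\<lambda>v w. 1 / h - 1 / (3 * h\<^sup>2) * rate_gain w)"
  proof (rule friend_avg_mono)
    fix v w assume "w \<in> nbrs E v"
    then have w: "w \<in> {1..n}" using nbrs_subset by blast
    define g where "g = rate_gain w"
    have g: "0 \<le> g" "g \<le> 1" using rate_gain_bounds[OF n3 w] by (auto simp: g_def)
    have "1 / leaf_rate (Suc n) (insert {w, Suc n} E) \<le> 1 / (h + g)"
      using leaf_rate_attach[OF n3 w] h g by (intro divide_left_mono) (auto simp: h_def g_def)
    also have "\<dots> = 1 / h - g / (h * (h + g))"
    proof -
      have "h \<noteq> 0" "h + g \<noteq> 0" using h g by auto
      then show ?thesis by (simp add: divide_simps)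
    qed
    also have "\<dots> \<le> 1 / h - g / (h * (3 * h))"
      using h g by (intro diff_left_mono divide_left_mono mult_left_mono) auto
    finally show "1 / leaf_rate (Suc n) (insert {w, Suc n} E) \<le> 1 / h - 1 / (3 * h\<^sup>2) * rate_gain w"
      by (simp add: g_def power2_eq_square mult_ac)
  qed
  also have "\<dots> = 1 / h - 1 / (3 * h\<^sup>2) * friend_avg n E (\<lambda>v w. rate_gain w)"
    by (simp only: friend_avg_diff friend_avg_cmult friend_avg_const)
  also have "\<dots> \<le> 1 / h - 1 / (3 * h\<^sup>2) * (h / (6 * n))"
    unfolding h_def by (intro diff_left_mono mult_left_mono rate_gain_avg n) auto
  also have "\<dots> = (1 - 1 / (18 * n)) * (1 / h)" using h n by (simp add: field_simps power2_eq_square)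
  finally show ?thesis by (simp add: h_def)
qed

end

lemma powr_minus_step:
  assumes c: "0 < c" and n: "0 < (n::nat)"
  shows "(1 - c / n) * real n powr (- c) \<le> real (Suc n) powr (- c)"
proof -
  have "1 - c / n \<le> exp (- (c / n))" using exp_ge_add_one_self[of "- (c / n)"] by simp
  also have "\<dots> \<le> exp (- (c * (ln (real (Suc n)) - ln (real n))))"
  proof -
    have "ln (real (Suc n)) - ln (real n) = ln (1 + 1 / n)"
    proof -
      have "real (Suc n) = real n * (1 + 1 / n)" using n by (simp add: field_simps)
      moreover have "1 + 1 / real n > 0" by (rule add_pos_nonneg) auto
      ultimately show ?thesis using n ln_mult[of "real n" "1 + 1 / n"] by simp
    qed
    also have "\<dots> \<le> 1 / n" by (rule ln_add_one_self_le_self) simp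
    finally have "c * (ln (real (Suc n)) - ln (real n)) \<le> c * (1 / n)" using c by (intro mult_left_mono) auto
    then show ?thesis by simp
  qed
  finally have "(1 - c / n) * real n powr (- c) \<le> exp (- (c * (ln (real (Suc n)) - ln (real n)))) * real n powr (- c)"
    by (intro mult_right_mono) auto
  also have "\<dots> = real (Suc n) powr (- c)"
    using n by (simp add: powr_def algebra_simps flip: exp_add)
  finally show ?thesis .
qed

lemma inverse_leaf_rate_decay:
  obtains K :: real where "K > 0"
    "\<And>n. 4 \<le> n \<Longrightarrow> measure_pmf.expectation (friend_pmf n) (\<lambda>E. 1 / leaf_rate n E) \<le> K * real n powr (- (1/18))"
proof
  define K where "K = (\<bar>measure_pmf.expectation (friend_pmf 4) (\<lambda>E. 1 / leaf_rate 4 E)\<bar> + 1) / 4 powr (- (1/18))"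
  show K: "K > 0" by (simp add: K_def)
  fix n :: nat assume "4 \<le> n"
  then show "measure_pmf.expectation (friend_pmf n) (\<lambda>E. 1 / leaf_rate n E) \<le> K * real n powr (- (1/18))"
  proof (induction n rule: dec_induct)
    case base
    then show ?case by (simp add: K_def)
  next
    case (step n)
    have "measure_pmf.expectation (friend_pmf (Suc n)) (\<lambda>E. 1 / leaf_rate (Suc n) E) \<le>
      (1 - 1 / (18 * n)) * measure_pmf.expectation (friend_pmf n) (\<lambda>E. 1 / leaf_rate n E) + 0"
      using step(1) rec_tree.inverse_leaf_rate_step by (intro friend_pmf_expectation_le) auto
    also have "\<dots> \<le> (1 - 1 / (18 * n)) * (K * real n powr (- (1/18)))"
      using step by (simp only: add_0_right, intro mult_left_mono) (auto simp: field_simps)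
    also have "\<dots> = K * ((1 - (1/18) / n) * real n powr (- (1/18)))" by simp
    also have "\<dots> \<le> K * real (Suc n) powr (- (1/18))"
      using K step(1) by (intro mult_left_mono powr_minus_step) auto
    finally show ?case .
  qed
qed

lemma prob_leaf_rate_small:
  obtains K :: real where "K > 0"
    "\<And>n h. 4 \<le> n \<Longrightarrow> 0 < h \<Longrightarrow> measure_pmf.prob (friend_pmf n) {E. leaf_rate n E < h} \<le> K * h * real n powr (- (1/18))"
proof -
  obtain K :: real where K: "K > 0"
    "\<And>n. 4 \<le> n \<Longrightarrow> measure_pmf.expectation (friend_pmf n) (\<lambda>E. 1 / leaf_rate n E) \<le> K * real n powr (- (1/18))"
    using inverse_leaf_rate_decay by blast
  show ?thesis
  proof (rule that[OF K(1)])
    fix n :: nat and h :: real assume n: "4 \<le> n" and h: "0 < h"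
    have "measure_pmf.prob (friend_pmf n) {E. leaf_rate n E < h}
      \<le> measure_pmf.expectation (friend_pmf n) (\<lambda>E. 1 / leaf_rate n E) / (1 / h)"
    proof (rule friend_pmf_Markov)
      fix E p assume "rec_tree n E p"
      then have *: "leaf_rate n E \<ge> 1/2" using n by (intro rec_tree.leaf_rate_ge_half) auto
      then show "0 \<le> 1 / leaf_rate n E" by simp
      assume "E \<in> {E. leaf_rate n E < h}"
      then show "1 / h \<le> 1 / leaf_rate n E" using * by (intro divide_left_mono) auto
    qed (use n h in auto)
    also have "\<dots> \<le> K * real n powr (- (1/18)) / (1 / h)"
      using K(2)[OF n] h by (intro divide_right_mono) auto
    finally show "measure_pmf.prob (friend_pmf n) {E. leaf_rate n E < h} \<le> K * h * real n powr (- (1/18))"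
      by (simp add: mult_ac)
  qed
qed

section \<open>Pendant chains\<close>

text \<open>The ancestors of degree two met when climbing from \<open>x\<close>, at most \<open>k\<close> of them. Using \<open>Min (nbrs E x)\<close>
  for the parent of \<open>x\<close> makes the chain a function of the tree alone, and the bound \<open>k\<close> makes vertices
  beyond the first \<open>k\<close> irrelevant, so that a chain is spoilt at rate at most \<open>2 k / n\<close>. The root is
  never part of a chain: it could have two children.\<close>

primrec pendant_chain :: "nat set set \<Rightarrow> nat \<Rightarrow> nat \<Rightarrow> nat list" where
  "pendant_chain E 0 x = []"
| "pendant_chain E (Suc k) x =
    (if 2 \<le> x \<and> vertex_degree E x = 2 then x # pendant_chain E k (Min (nbrs E x)) else [])"

definition chain_length :: "nat \<Rightarrow> nat set set \<Rightarrow> nat \<Rightarrow> nat" where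
  "chain_length k E l = length (pendant_chain E k (Min (nbrs E l)))"

definition tips :: "nat \<Rightarrow> nat set set \<Rightarrow> nat set" where
  "tips n E = leaves n E - {1}"

definition chain_potential :: "(nat \<Rightarrow> real) \<Rightarrow> nat \<Rightarrow> nat \<Rightarrow> nat set set \<Rightarrow> real" where
  "chain_potential \<alpha> k n E = (\<Sum>l\<in>tips n E. \<alpha> (chain_length k E l))"

lemma pendant_chain_vertex: "x \<in> set (pendant_chain E k y) \<Longrightarrow> 2 \<le> x \<and> vertex_degree E x = 2"
  by (induction k arbitrary: y) (auto split: if_splits)

lemma length_pendant_chain: "length (pendant_chain E k x) \<le> k"
  by (induction k arbitrary: x) auto

lemma length_pendant_chain_Suc:
  "length (pendant_chain E k x) = min k (length (pendant_chain E (Suc k) x))"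
proof (induction k arbitrary: x)
  case (Suc k)
  show ?case
  proof (cases "2 \<le> x \<and> vertex_degree E x = 2")
    case True
    then show ?thesis using Suc[of "Min (nbrs E x)"] by (simp del: pendant_chain.simps add: pendant_chain.simps(2)[of E k x] pendant_chain.simps(2)[of E "Suc k" x])
  qed auto
qed simp

lemma pendant_chain_pred:
  "w \<in> set (pendant_chain E k x) \<Longrightarrow> w = x \<or> (\<exists>y\<in>set (pendant_chain E k x). w = Min (nbrs E y))"
proof (induction k arbitrary: x)
  case (Suc k)
  then show ?case by (auto split: if_splits)
qed simp

context rec_tree
begin

lemma Min_nbrs: "x \<in> {2..n} \<Longrightarrow> Min (nbrs E x) = p x"
proof (rule Min_eqI)
  fix y assume "x \<in> {2..n}" "y \<in> nbrs E x"
  then show "p x \<le> y" using parent[of x] parent[of y] by (auto simp: nbrs_eq)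
qed (auto simp: nbrs_eq)

lemma finite_tips [simp]: "finite (tips n E)"
  by (simp add: tips_def)

lemma tipsD:
  assumes "l \<in> tips n E"
  shows "l \<in> {2..n}" "l \<in> leaves n E" "nbrs E l = {p l}" "vertex_degree E l = 1" "Min (nbrs E l) = p l" "p l \<in> {1..n}"
proof -
  show l: "l \<in> {2..n}" "l \<in> leaves n E" "vertex_degree E l = 1" using assms by (auto simp: tips_def leaves_def)
  then show "Min (nbrs E l) = p l" by (intro Min_nbrs)
  have "p l \<in> nbrs E l" using l by (simp add: nbrs_eq)
  then show "nbrs E l = {p l}" using leaf_nbrs[OF l(2)] by auto
  show "p l \<in> {1..n}" using parent[OF l(1)] l(1) by auto
qed

lemma tip_childless: "w \<in> tips n E \<Longrightarrow> y \<in> {2..n} \<Longrightarrow> p y \<noteq> w"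
proof
  assume w: "w \<in> tips n E" and y: "y \<in> {2..n}" "p y = w"
  then have "y \<in> nbrs E w" by (simp add: nbrs_eq)
  then have "y = p w" using tipsD(3)[OF w] by simp
  then show False using y parent[of y] parent[of w] tipsD(1)[OF w] by auto
qed

lemma tips_attach:
  assumes "w \<in> {1..n}"
  shows "tips (Suc n) (insert {w, Suc n} E) = insert (Suc n) (tips n E - {w})"
  using n_ge_2 by (auto simp: tips_def leaves_attach[OF assms])

lemma new_not_tip: "Suc n \<notin> tips n E"
  by (auto simp: tips_def leaves_def)

lemma Min_nbrs_attach:
  assumes w: "w \<in> {1..n}" and x: "x \<in> {2..n}"
  shows "Min (nbrs (insert {w, Suc n} E) x) = Min (nbrs E x)"
  using rec_tree.Min_nbrs[OF attach[OF w], of x] Min_nbrs[OF x] x by auto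

text \<open>Attaching to \<open>w\<close> raises its degree. This can remove \<open>w\<close> from a chain, if its degree was two, or
  admit it to one, if it was a leaf; but no chain except one starting at \<open>w\<close> climbs through a leaf,
  since a tip has no children.\<close>

lemma pendant_chain_attach:
  assumes w: "w \<in> {1..n}" and x: "x \<in> {1..n}"
    and notin: "w \<notin> set (pendant_chain E k x)"
    and unaffected: "vertex_degree E w \<ge> 2 \<or> w = 1 \<or> w \<in> tips n E \<and> x \<noteq> w"
  shows "pendant_chain (insert {w, Suc n} E) k x = pendant_chain E k x"
  using x notin unaffected
proof (induction k arbitrary: x)
  case (Suc k)
  show ?case
  proof (cases "2 \<le> x \<and> vertex_degree E x = 2")
    case True
    then have xw: "x \<noteq> w" using Suc.prems by auto
    have x2: "x \<in> {2..n}" using True Suc.prems by auto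
    have px: "p x \<in> {1..n}" "Min (nbrs E x) = p x" using parent[OF x2] x2 Min_nbrs[OF x2] by auto
    have "w \<in> tips n E \<Longrightarrow> p x \<noteq> w" using tip_childless x2 by blast
    moreover have "w \<notin> set (pendant_chain E k (p x))" using Suc.prems True px by auto
    ultimately have "pendant_chain (insert {w, Suc n} E) k (p x) = pendant_chain E k (p x)"
      using Suc.IH[OF px(1)] Suc.prems(3) by blast
    then show ?thesis using True xw Suc.prems Min_nbrs_attach[OF w x2] px
      by (auto simp: degree_attach[OF w])
  next
    case False
    then have "\<not> (2 \<le> x \<and> vertex_degree (insert {w, Suc n} E) x = 2)"
      using Suc.prems by (auto simp: degree_attach[OF w])
    then show ?thesis using False by auto
  qed
qed simp

lemma chain_length_le: "chain_length k E l \<le> k"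
  by (simp add: chain_length_def length_pendant_chain)

lemma chain_length_attach:
  assumes w: "w \<in> {1..n}" and l: "l \<in> tips n E" "l \<noteq> w"
    and "w \<in> leaves n E \<or> w \<notin> set (pendant_chain E k (p l))"
  shows "chain_length k (insert {w, Suc n} E) l = chain_length k E l"
proof -
  note t = tipsD[OF l(1)]
  have "Min (nbrs (insert {w, Suc n} E) l) = p l" using Min_nbrs_attach[OF w t(1)] t(5) by simp
  moreover have "pendant_chain (insert {w, Suc n} E) k (p l) = pendant_chain E k (p l)"
  proof (rule pendant_chain_attach[OF w t(6)])
    show "w \<notin> set (pendant_chain E k (p l))"
      using assms(4) pendant_chain_vertex[of w E k "p l"] by (auto simp: leaves_def)
    show "2 \<le> vertex_degree E w \<or> w = 1 \<or> w \<in> tips n E \<and> p l \<noteq> w"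
    proof (cases "w \<in> leaves n E")
      case True
      then show ?thesis using tip_childless[OF _ t(1)] by (auto simp: tips_def)
    next
      case False
      then show ?thesis using w degree_pos[OF w] by (auto simp: leaves_def)
    qed
  qed
  ultimately show ?thesis by (simp add: chain_length_def t(5))
qed

lemma chain_length_extend:
  assumes w: "w \<in> tips n E"
  shows "chain_length k (insert {w, Suc n} E) (Suc n) = min k (Suc (chain_length k E w))"
proof -
  note t = tipsD[OF w]
  have wV: "w \<in> {1..n}" using t(1) by auto
  let ?E = "insert {w, Suc n} E"
  have new: "Min (nbrs ?E (Suc n)) = w" using wV by (simp add: nbrs_attach[OF wV])
  show ?thesis
  proof (cases k)
    case (Suc j)
    have "pendant_chain ?E j (p w) = pendant_chain E j (p w)"
    proof (rule pendant_chain_attach[OF wV t(6)])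
      show "w \<notin> set (pendant_chain E j (p w))" using pendant_chain_vertex[of w E j "p w"] t(4) by auto
      show "2 \<le> vertex_degree E w \<or> w = 1 \<or> w \<in> tips n E \<and> p w \<noteq> w" using tip_childless[OF w t(1)] w by blast
    qed
    then have "chain_length k ?E (Suc n) = Suc (length (pendant_chain E j (p w)))"
      using t(1,4) Min_nbrs_attach[OF wV t(1)] t(5) by (simp add: chain_length_def new Suc degree_attach[OF wV])
    also have "\<dots> = min k (Suc (chain_length k E w))"
      using length_pendant_chain_Suc[of E j "p w"] unfolding chain_length_def t(5) Suc by simp
    finally show ?thesis .
  qed (simp add: chain_length_def)
qed

lemma unique_child:
  assumes "w \<in> {2..n}" "vertex_degree E w = 2" "x \<in> {2..n}" "y \<in> {2..n}" "p x = w" "p y = w"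
  shows "x = y"
proof (rule ccontr)
  assume "x \<noteq> y"
  have "{p w, x, y} \<subseteq> nbrs E w" using assms by (auto simp: nbrs_eq)
  then have "card {p w, x, y} \<le> 2" using assms(2) card_mono[of "nbrs E w" "{p w, x, y}"] by (simp add: vertex_degree_def)
  moreover have "p w < w" "w < x" "w < y" using parent[of w] parent[of x] parent[of y] assms by auto
  ultimately show False using \<open>x \<noteq> y\<close> by auto
qed

lemma pendant_chain_subset: "x \<in> {1..n} \<Longrightarrow> set (pendant_chain E k x) \<subseteq> {2..n}"
proof (induction k arbitrary: x)
  case (Suc k)
  show ?case
  proof (cases "2 \<le> x \<and> vertex_degree E x = 2")
    case True
    then have x2: "x \<in> {2..n}" using Suc.prems by auto
    then have "p x \<in> {1..n}" "Min (nbrs E x) = p x" using parent[OF x2] x2 Min_nbrs by auto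
    then show ?thesis using Suc.IH[of "p x"] True x2 by auto
  qed auto
qed simp

text \<open>Below a vertex of degree two other than the root hangs exactly one child. Descending along these
  children from \<open>w\<close> ends in the leaf that carries the chain, hence determines it.\<close>

lemma chain_tip_unique:
  assumes "l \<in> tips n E" "l' \<in> tips n E" "w \<in> set (pendant_chain E k (p l))" "w \<in> set (pendant_chain E k (p l'))"
  shows "l = l'"
  using assms(3,4)
proof (induction "n - w" arbitrary: w rule: less_induct)
  case less
  have sub: "set (pendant_chain E k (p l)) \<subseteq> {2..n}" "set (pendant_chain E k (p l')) \<subseteq> {2..n}"
    using tipsD(6) assms(1,2) by (blast intro!: pendant_chain_subset)+
  have child: "\<exists>y\<in>{2..n}. p y = w \<and> (y = m \<or> y \<in> set (pendant_chain E k (p m)))"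
    if "m \<in> tips n E" "w \<in> set (pendant_chain E k (p m))" for m
  proof -
    have s: "set (pendant_chain E k (p m)) \<subseteq> {2..n}" using tipsD(6)[OF that(1)] by (rule pendant_chain_subset)
    from pendant_chain_pred[OF that(2)] show ?thesis
    proof
      assume "w = p m"
      then show ?thesis using tipsD(1)[OF that(1)] by blast
    next
      assume "\<exists>y\<in>set (pendant_chain E k (p m)). w = Min (nbrs E y)"
      then obtain y where "y \<in> set (pendant_chain E k (p m))" "w = Min (nbrs E y)" by blast
      moreover from this have "y \<in> {2..n}" using s by blast
      ultimately show ?thesis using Min_nbrs[of y] by (intro bexI[of _ y]) auto
    qed
  qed
  obtain y where y: "y \<in> {2..n}" "p y = w" "y = l \<or> y \<in> set (pendant_chain E k (p l))"
    using child[OF assms(1) less.prems(1)] by blast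
  obtain y' where y': "y' \<in> {2..n}" "p y' = w" "y' = l' \<or> y' \<in> set (pendant_chain E k (p l'))"
    using child[OF assms(2) less.prems(2)] by blast
  have "w \<in> {2..n}" "vertex_degree E w = 2" using less.prems(1) sub(1) pendant_chain_vertex by blast+
  then have yy: "y = y'" by (rule unique_child[OF _ _ y(1) y'(1) y(2) y'(2)])
  have dl: "vertex_degree E l = 1" "vertex_degree E l' = 1" using tipsD(4) assms by blast+
  show ?case
  proof (cases "y = l \<or> y' = l'")
    case True
    have "l \<notin> set (pendant_chain E k x)" "l' \<notin> set (pendant_chain E k x)" for x
      using dl pendant_chain_vertex[of l E k x] pendant_chain_vertex[of l' E k x] by auto
    then show ?thesis using True y(3) y'(3) yy by auto
  next
    case False
    have "w < y" "y \<le> n" using parent[OF y(1)] y by auto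
    then have "n - y < n - w" by auto
    moreover have "y \<in> set (pendant_chain E k (p l))" "y \<in> set (pendant_chain E k (p l'))"
      using y(3) y'(3) yy False by auto
    ultimately show ?thesis by (rule less.hyps)
  qed
qed

text \<open>The largest possible loss of potential when the new vertex is attached to \<open>w\<close>. By uniqueness of
  the chain through \<open>w\<close> at most one summand is nonzero.\<close>

definition chain_damage :: "(nat \<Rightarrow> real) \<Rightarrow> nat \<Rightarrow> nat \<Rightarrow> real" where
  "chain_damage \<alpha> k w = (\<Sum>l\<in>tips n E. if w \<in> set (pendant_chain E k (p l)) then \<alpha> (chain_length k E l) else 0)"

lemma chain_damage_bounds:
  assumes "\<And>j. 0 \<le> (\<alpha> j :: real)" "\<And>j. j \<le> k \<Longrightarrow> \<alpha> j \<le> (1::real)"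
  shows "0 \<le> chain_damage \<alpha> k w" "chain_damage \<alpha> k w \<le> 1"
proof -
  show "0 \<le> chain_damage \<alpha> k w" unfolding chain_damage_def using assms by (intro sum_nonneg) auto
  show "chain_damage \<alpha> k w \<le> 1"
  proof (cases "\<exists>l\<in>tips n E. w \<in> set (pendant_chain E k (p l))")
    case True
    then obtain l where l: "l \<in> tips n E" "w \<in> set (pendant_chain E k (p l))" by blast
    have "chain_damage \<alpha> k w = (\<Sum>m\<in>tips n E. if m = l then \<alpha> (chain_length k E l) else 0)"
      unfolding chain_damage_def
    proof (intro sum.cong refl)
      fix m assume m: "m \<in> tips n E"
      have "w \<in> set (pendant_chain E k (p m)) \<longleftrightarrow> m = l" using chain_tip_unique[OF m l(1) _ l(2)] l(2) by auto
      then show "(if w \<in> set (pendant_chain E k (p m)) then \<alpha> (chain_length k E m) else 0) =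
        (if m = l then \<alpha> (chain_length k E l) else 0)" by simp
    qed
    also have "\<dots> = \<alpha> (chain_length k E l)" using l by simp
    also have "\<dots> \<le> 1" by (rule assms(2)[OF chain_length_le])
    finally show ?thesis .
  qed (auto simp: chain_damage_def)
qed

lemma chain_potential_attach:
  assumes w: "w \<in> {1..n}" and nonneg: "\<And>j. 0 \<le> (\<alpha> j :: real)"
  shows "chain_potential \<alpha> k (Suc n) (insert {w, Suc n} E) \<ge> chain_potential \<alpha> k n E +
    (if w \<in> tips n E then \<alpha> (min k (Suc (chain_length k E w))) - \<alpha> (chain_length k E w) else - chain_damage \<alpha> k w)"
proof -
  let ?E = "insert {w, Suc n} E"
  have eq: "chain_potential \<alpha> k (Suc n) ?E = \<alpha> (chain_length k ?E (Suc n)) + (\<Sum>l\<in>tips n E - {w}. \<alpha> (chain_length k ?E l))"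
    unfolding chain_potential_def tips_attach[OF w] using new_not_tip by simp
  show ?thesis
  proof (cases "w \<in> tips n E")
    case True
    then have "w \<in> leaves n E" by (simp add: tips_def)
    then have "(\<Sum>l\<in>tips n E - {w}. \<alpha> (chain_length k ?E l)) = (\<Sum>l\<in>tips n E - {w}. \<alpha> (chain_length k E l))"
      using chain_length_attach[OF w] by (intro sum.cong) auto
    also have "\<dots> = chain_potential \<alpha> k n E - \<alpha> (chain_length k E w)"
      unfolding chain_potential_def using True by (simp add: sum_diff1)
    finally show ?thesis using True unfolding eq by (simp add: chain_length_extend)
  next
    case False
    then have "tips n E - {w} = tips n E" by blast
    moreover have "chain_potential \<alpha> k n E - chain_damage \<alpha> k w \<le> (\<Sum>l\<in>tips n E. \<alpha> (chain_length k ?E l))"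
      unfolding chain_potential_def chain_damage_def sum_subtractf[symmetric]
    proof (rule sum_mono)
      fix l assume l: "l \<in> tips n E"
      show "\<alpha> (chain_length k E l) - (if w \<in> set (pendant_chain E k (p l)) then \<alpha> (chain_length k E l) else 0)
        \<le> \<alpha> (chain_length k ?E l)"
      proof -
        have "l \<noteq> w" using l False by blast
        then show ?thesis using chain_length_attach[OF w l, of k] nonneg by auto
      qed
    qed
    ultimately show ?thesis using False nonneg[of "chain_length k ?E (Suc n)"] unfolding eq by simp
  qed
qed

lemma degree_2_attach_prob_le:
  assumes "vertex_degree E w = 2"
  shows "attach_prob w \<le> 2 / n"
proof -
  have "attach_prob w \<le> (\<Sum>v\<in>nbrs E w. 1 / n)"
    unfolding attach_prob_def
  proof (rule sum_mono)
    fix v assume "v \<in> nbrs E w"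
    then have "vertex_degree E v \<ge> 1" using nbrs_subset degree_pos by blast
    then show "1 / (real n * real (vertex_degree E v)) \<le> 1 / n" using n_ge_2 by (intro divide_left_mono) auto
  qed
  then show ?thesis using assms by (simp add: vertex_degree_def)
qed

lemma chain_damage_avg:
  assumes nonneg: "\<And>j. 0 \<le> (\<alpha> j :: real)"
  shows "(\<Sum>w\<in>{1..n}. chain_damage \<alpha> k w * attach_prob w)
    \<le> (\<Sum>l\<in>tips n E. 2 * real (chain_length k E l) * \<alpha> (chain_length k E l)) / n"
proof -
  have "(\<Sum>w\<in>{1..n}. chain_damage \<alpha> k w * attach_prob w) =
    (\<Sum>w\<in>{1..n}. \<Sum>l\<in>tips n E. if w \<in> set (pendant_chain E k (p l)) then \<alpha> (chain_length k E l) * attach_prob w else 0)"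
    unfolding chain_damage_def sum_distrib_right by (intro sum.cong refl) auto
  also have "\<dots> = (\<Sum>l\<in>tips n E. \<Sum>w\<in>{1..n}. if w \<in> set (pendant_chain E k (p l)) then \<alpha> (chain_length k E l) * attach_prob w else 0)"
    by (rule sum.swap)
  also have "\<dots> \<le> (\<Sum>l\<in>tips n E. 2 * real (chain_length k E l) * \<alpha> (chain_length k E l) / n)"
  proof (rule sum_mono)
    fix l assume l: "l \<in> tips n E"
    let ?C = "set (pendant_chain E k (p l))" and ?a = "\<alpha> (chain_length k E l)"
    have "?C \<subseteq> {1..n}" using pendant_chain_subset[OF tipsD(6)[OF l], of k] by fastforce
    then have "(\<Sum>w\<in>{1..n}. if w \<in> ?C then ?a * attach_prob w else 0) = (\<Sum>w\<in>?C. ?a * attach_prob w)"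
      by (subst sum.inter_restrict[symmetric]) (auto simp: Int_absorb1)
    also have "\<dots> \<le> (\<Sum>w\<in>?C. ?a * (2 / n))"
    proof (intro sum_mono mult_left_mono nonneg)
      fix w assume "w \<in> ?C"
      then have "vertex_degree E w = 2" using pendant_chain_vertex by blast
      then show "attach_prob w \<le> 2 / n" by (rule degree_2_attach_prob_le)
    qed
    also have "\<dots> = card ?C * (?a * (2 / n))" by simp
    also have "\<dots> \<le> chain_length k E l * (?a * (2 / n))"
      unfolding chain_length_def tipsD(5)[OF l] using nonneg by (intro mult_right_mono) (auto simp: card_length)
    finally show "(\<Sum>w\<in>{1..n}. if w \<in> ?C then ?a * attach_prob w else 0) \<le> 2 * real (chain_length k E l) * ?a / n"
      by (simp add: mult_ac)
  qed
  finally show ?thesis by (simp add: sum_divide_distrib)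
qed

text \<open>Either the chain of the tip \<open>W\<close> is extended, a gain \<open>u\<close> of potential, or at most one chain is damaged, a
  loss \<open>z\<close>; both lie in \<open>[0, 1]\<close>. There the exponential can be linearised at the cost of constant
  factors, \<open>exp (- u / 2) \<le> 1 - u / 4\<close> and \<open>exp (z / 2) \<le> 1 + z\<close>. The linear function is averaged, and
  \<open>1 + x \<le> exp x\<close> restores the exponential.\<close>

lemma chain_potential_exp_step:
  assumes nonneg: "\<And>j. 0 \<le> (\<alpha> j :: real)" and le1: "\<And>j. j \<le> k \<Longrightarrow> \<alpha> j \<le> (1::real)"
    and mono: "\<And>i j. i \<le> j \<Longrightarrow> j \<le> k \<Longrightarrow> \<alpha> i \<le> \<alpha> j"
  shows "friend_avg n E (\<lambda>v w. exp (- chain_potential \<alpha> k (Suc n) (insert {w, Suc n} E) / 2)) \<le>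
    exp (- (chain_potential \<alpha> k n E + (\<Sum>l\<in>tips n E.
       (\<alpha> (min k (Suc (chain_length k E l))) - \<alpha> (chain_length k E l)) / (2 * real (vertex_degree E (p l)))
         - 4 * real (chain_length k E l) * \<alpha> (chain_length k E l)) / n) / 2)"
proof -
  define \<phi> where "\<phi> = chain_potential \<alpha> k n E"
  define up where "up w = \<alpha> (min k (Suc (chain_length k E w))) - \<alpha> (chain_length k E w)" for w
  define z where "z w = chain_damage \<alpha> k w" for w
  have up: "0 \<le> up w" "up w \<le> 1" for w
  proof -
    show "0 \<le> up w" unfolding up_def using mono[of "chain_length k E w" "min k (Suc (chain_length k E w))"] chain_length_le[of k w] by simp
    show "up w \<le> 1" unfolding up_def using le1[of "min k (Suc (chain_length k E w))"] nonneg[of "chain_length k E w"] by simp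
  qed
  have z: "0 \<le> z w" "z w \<le> 1" for w unfolding z_def using chain_damage_bounds[of \<alpha> k, OF nonneg le1] by auto
  let ?g = "\<lambda>w. (if w \<in> tips n E then - (up w / 4) else 0) + z w"
  have bound: "exp (- chain_potential \<alpha> k (Suc n) (insert {w, Suc n} E) / 2) \<le> exp (- \<phi> / 2) * (1 + ?g w)"
    if w: "w \<in> {1..n}" for w
  proof -
    have "exp (- chain_potential \<alpha> k (Suc n) (insert {w, Suc n} E) / 2) \<le>
      exp (- (\<phi> + (if w \<in> tips n E then up w else - z w)) / 2)"
      using chain_potential_attach[OF w, of \<alpha> k, OF nonneg] unfolding \<phi>_def up_def z_def by simp
    also have "\<dots> = exp (- \<phi> / 2) * exp (- (if w \<in> tips n E then up w else - z w) / 2)"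
      by (simp add: diff_divide_distrib add_divide_distrib flip: exp_add)
    also have "\<dots> \<le> exp (- \<phi> / 2) * (1 + ?g w)"
    proof (rule mult_left_mono)
      show "exp (- (if w \<in> tips n E then up w else - z w) / 2) \<le> 1 + ?g w"
      proof (cases "w \<in> tips n E")
        case True
        have "exp (- (up w / 2)) \<le> 1 / (1 + up w / 2)"
          using exp_ge_add_one_self[of "up w / 2"] up[of w] by (simp add: exp_minus field_simps)
        also have "\<dots> \<le> 1 - up w / 4"
        proof -
          have "0 \<le> up w * (1 - up w / 2) / 4" using up[of w] by (intro divide_nonneg_pos mult_nonneg_nonneg) auto
          then have "1 \<le> (1 - up w / 4) * (1 + up w / 2)" by (simp add: algebra_simps)
          then show ?thesis using up[of w] by (simp add: pos_divide_le_eq)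
        qed
        finally show ?thesis using True z[of w] by simp
      next
        case False
        have "exp (z w / 2) \<le> 1 + z w / 2 + (z w / 2)\<^sup>2" by (rule exp_bound) (use z[of w] in auto)
        also have "(z w / 2)\<^sup>2 \<le> z w / 2"
          using z[of w] mult_mono[of "z w / 2" 1 "z w / 2" "z w / 2"] by (simp add: power2_eq_square)
        finally show ?thesis using False by simp
      qed
    qed simp
    finally show ?thesis .
  qed
  have "friend_avg n E (\<lambda>v w. exp (- chain_potential \<alpha> k (Suc n) (insert {w, Suc n} E) / 2)) \<le>
    friend_avg n E (\<lambda>v w. exp (- \<phi> / 2) * (1 + ?g w))"
    using bound nbrs_subset by (intro friend_avg_mono) blast
  also have "\<dots> = exp (- \<phi> / 2) * (1 + friend_avg n E (\<lambda>v w. ?g w))"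
    by (simp only: friend_avg_cmult friend_avg_add friend_avg_const)
  also have "friend_avg n E (\<lambda>v w. ?g w) = (\<Sum>w\<in>{1..n}. (if w \<in> tips n E then - (up w / 4) else 0) * attach_prob w)
     + (\<Sum>w\<in>{1..n}. z w * attach_prob w)"
    by (simp only: friend_avg_snd distrib_right sum.distrib)
  also have "(\<Sum>w\<in>{1..n}. (if w \<in> tips n E then - (up w / 4) else 0) * attach_prob w)
     = (\<Sum>w\<in>tips n E. - (up w / 4) * attach_prob w)"
  proof -
    have sub: "tips n E \<subseteq> {1..n}" by (auto simp: tips_def leaves_def)
    have "(\<Sum>w\<in>{1..n}. (if w \<in> tips n E then - (up w / 4) else 0) * attach_prob w) =
      (\<Sum>w\<in>{1..n}. if w \<in> tips n E then - (up w / 4) * attach_prob w else 0)"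
      by (intro sum.cong) auto
    also have "\<dots> = (\<Sum>w\<in>tips n E. - (up w / 4) * attach_prob w)"
      using sub by (subst sum.inter_restrict[symmetric]) (auto simp: Int_absorb1)
    finally show ?thesis .
  qed
  also have "(\<Sum>w\<in>tips n E. - (up w / 4) * attach_prob w) = (\<Sum>l\<in>tips n E. - (up l / (2 * real (vertex_degree E (p l))) / n / 2))"
  proof (intro sum.cong refl)
    fix l assume "l \<in> tips n E"
    from leaf_attach_prob[OF tipsD(3)[OF this]]
    show "- (up l / 4) * attach_prob l = - (up l / (2 * real (vertex_degree E (p l))) / n / 2)" by (simp add: mult_ac)
  qed
  also have "(\<Sum>w\<in>{1..n}. z w * attach_prob w) \<le> (\<Sum>l\<in>tips n E. 2 * real (chain_length k E l) * \<alpha> (chain_length k E l)) / n"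
    unfolding z_def by (rule chain_damage_avg[of \<alpha> k, OF nonneg])
  also have "(\<Sum>l\<in>tips n E. - (up l / (2 * real (vertex_degree E (p l))) / n / 2)) + \<dots> =
    - ((\<Sum>l\<in>tips n E. up l / (2 * real (vertex_degree E (p l))) - 4 * real (chain_length k E l) * \<alpha> (chain_length k E l)) / n / 2)"
    by (simp add: sum_subtractf sum_divide_distrib sum_negf diff_divide_distrib mult.assoc)
  also have "exp (- \<phi> / 2) * (1 + - ((\<Sum>l\<in>tips n E. up l / (2 * real (vertex_degree E (p l))) - 4 * real (chain_length k E l) * \<alpha> (chain_length k E l)) / n / 2))
    \<le> exp (- \<phi> / 2) * exp (- ((\<Sum>l\<in>tips n E. up l / (2 * real (vertex_degree E (p l))) - 4 * real (chain_length k E l) * \<alpha> (chain_length k E l)) / n / 2))"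
    by (intro mult_left_mono exp_ge_add_one_self) auto
  also have "\<dots> = exp (- (\<phi> + (\<Sum>l\<in>tips n E. up l / (2 * real (vertex_degree E (p l))) - 4 * real (chain_length k E l) * \<alpha> (chain_length k E l)) / n) / 2)"
    by (simp add: add_divide_distrib flip: exp_add)
  finally show ?thesis unfolding \<phi>_def up_def by simp
qed

text \<open>The hypothesis on \<open>\<beta>\<close> says that \<open>\<beta> j\<close> is covered by the weight of a chain of length \<open>j\<close> one step
  later. It sacrifices \<open>\<alpha> 1 / (4 n)\<close> for every chain of positive length. This is the share of such a
  chain's leaf in the birth term \<open>\<alpha> 1 * leaf_rate n E / (2 n)\<close>; together with the leaves of chain length \<open>0\<close>, whose extension yields
  a chain of length \<open>1\<close>, all leaves except the root then supply the whole birth term. The \<open>- 1\<close>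
  accounts for the root, in case it is a leaf.\<close>

lemma chain_potential_drift:
  fixes \<alpha> \<beta> :: "nat \<Rightarrow> real"
  assumes k: "1 \<le> k" and zero: "\<alpha> 0 = 0" "\<beta> 0 = 0" and nonneg: "0 \<le> \<alpha> 1" and le1: "\<alpha> 1 \<le> (1::real)"
    and weights: "\<And>j. 1 \<le> j \<Longrightarrow> j \<le> k \<Longrightarrow>
      \<beta> j \<le> \<alpha> j + ((\<alpha> (min k (Suc j)) - \<alpha> j - \<alpha> 1) / 4 - 4 * real j * \<alpha> j) / n"
  shows "chain_potential \<beta> k n E + \<alpha> 1 * max 0 (leaf_rate n E - 1) / (2 * n) \<le>
    chain_potential \<alpha> k n E + (\<Sum>l\<in>tips n E.
       (\<alpha> (min k (Suc (chain_length k E l))) - \<alpha> (chain_length k E l)) / (2 * real (vertex_degree E (p l)))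
         - 4 * real (chain_length k E l) * \<alpha> (chain_length k E l)) / n"
proof -
  let ?d = "\<lambda>l. real (vertex_degree E (p l))"
  have "leaf_rate n E \<le> (\<Sum>l\<in>tips n E. 1 / ?d l) + 1"
  proof -
    have "(\<Sum>l\<in>leaves n E \<inter> {1}. \<Sum>u\<in>nbrs E l. 1 / real (vertex_degree E u)) \<le> 1"
    proof (cases "1 \<in> leaves n E")
      case True
      then obtain u where "u \<in> {1..n}" "nbrs E 1 = {u}" using leaf_nbrs by blast
      then show ?thesis using True degree_pos[of u] by simp
    qed simp
    moreover have "(\<Sum>l\<in>tips n E. \<Sum>u\<in>nbrs E l. 1 / real (vertex_degree E u)) = (\<Sum>l\<in>tips n E. 1 / ?d l)"
      by (intro sum.cong refl) (simp add: tipsD(3))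
    ultimately show ?thesis
      unfolding leaf_rate_def tips_def
      by (subst sum.Int_Diff[of _ _ "{1}"]) auto
  qed
  moreover have "0 \<le> (\<Sum>l\<in>tips n E. 1 / ?d l)" by (intro sum_nonneg) auto
  ultimately have "max 0 (leaf_rate n E - 1) \<le> (\<Sum>l\<in>tips n E. 1 / ?d l)" by simp
  then have "\<alpha> 1 * max 0 (leaf_rate n E - 1) / (2 * n) \<le> \<alpha> 1 * (\<Sum>l\<in>tips n E. 1 / ?d l) / (2 * n)"
    using nonneg by (intro divide_right_mono mult_left_mono) auto
  also have "\<dots> = (\<Sum>l\<in>tips n E. \<alpha> 1 / (2 * n * ?d l))"
    by (simp add: sum_distrib_left sum_divide_distrib mult_ac)
  finally have "chain_potential \<beta> k n E + \<alpha> 1 * max 0 (leaf_rate n E - 1) / (2 * n)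
     \<le> (\<Sum>l\<in>tips n E. \<beta> (chain_length k E l) + \<alpha> 1 / (2 * n * ?d l))"
    by (simp add: chain_potential_def sum.distrib)
  also have "\<dots> \<le> (\<Sum>l\<in>tips n E. \<alpha> (chain_length k E l) +
      ((\<alpha> (min k (Suc (chain_length k E l))) - \<alpha> (chain_length k E l)) / (2 * ?d l)
         - 4 * real (chain_length k E l) * \<alpha> (chain_length k E l)) / n)"
  proof (rule sum_mono)
    fix l assume l: "l \<in> tips n E"
    define j where "j = chain_length k E l"
    have "\<beta> j + \<alpha> 1 / (2 * n * ?d l) \<le> \<alpha> j + ((\<alpha> (min k (Suc j)) - \<alpha> j) / (2 * ?d l) - 4 * real j * \<alpha> j) / n"
    proof (cases "j = 0")
      case True
      then show ?thesis using zero k by (simp add: mult_ac min_def)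
    next
      case False
      then have "pendant_chain E k (p l) \<noteq> []" by (auto simp: j_def chain_length_def tipsD(5)[OF l])
      then have "vertex_degree E (p l) = 2" by (cases k) (auto split: if_splits)
      moreover have "\<beta> j \<le> \<alpha> j + ((\<alpha> (min k (Suc j)) - \<alpha> j - \<alpha> 1) / 4 - 4 * real j * \<alpha> j) / n"
        using False chain_length_le[of k l] by (intro weights) (auto simp: j_def)
      ultimately show ?thesis by (simp add: diff_divide_distrib mult_ac)
    qed
    then show "\<beta> (chain_length k E l) + \<alpha> 1 / (2 * n * ?d l) \<le> \<alpha> (chain_length k E l) +
      ((\<alpha> (min k (Suc (chain_length k E l))) - \<alpha> (chain_length k E l)) / (2 * ?d l)
         - 4 * real (chain_length k E l) * \<alpha> (chain_length k E l)) / n"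
      by (simp add: j_def)
  qed
  also have "\<dots> = chain_potential \<alpha> k n E + (\<Sum>l\<in>tips n E.
       (\<alpha> (min k (Suc (chain_length k E l))) - \<alpha> (chain_length k E l)) / (2 * real (vertex_degree E (p l)))
         - 4 * real (chain_length k E l) * \<alpha> (chain_length k E l)) / n"
    by (simp only: chain_potential_def sum.distrib sum_divide_distrib)
  finally show ?thesis .
qed

text \<open>A walk of fewer than \<open>k div 2\<close> steps from the middle of the chain cannot leave it, because the
  neighbours of a chain vertex are its two neighbours on the chain; so it meets no leaf.\<close>

lemma max_leaf_dist_ge_chain:
  assumes l: "l \<in> tips n E" and len: "chain_length k E l = k"
  shows "k div 2 \<le> max_leaf_dist n E"
proof -
  define y where "y i = (p ^^ i) l" for i
  have chain: "x \<in> {1..n} \<Longrightarrow> length (pendant_chain E k x) = k \<Longrightarrow> i < k \<Longrightarrow>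
     (p ^^ i) x \<in> {2..n} \<and> vertex_degree E ((p ^^ i) x) = 2" for x k i
  proof (induction k arbitrary: x i)
    case (Suc k)
    then have x: "2 \<le> x \<and> vertex_degree E x = 2" by (auto split: if_splits)
    then have x2: "x \<in> {2..n}" using Suc.prems by auto
    then have px: "p x \<in> {1..n}" "Min (nbrs E x) = p x" using parent[OF x2] Min_nbrs[OF x2] by auto
    show ?case
    proof (cases i)
      case 0
      then show ?thesis using x x2 by simp
    next
      case (Suc i')
      then show ?thesis using Suc.IH[OF px(1), of i'] Suc.prems x px by (simp add: funpow_swap1)
    qed
  qed simp
  have y: "y i \<in> {2..n}" "vertex_degree E (y i) = 2" if "1 \<le> i" "i \<le> k" for i
  proof -
    have "(p ^^ (i - 1)) (p l) \<in> {2..n} \<and> vertex_degree E ((p ^^ (i - 1)) (p l)) = 2"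
      using len that tipsD[OF l] by (intro chain[where k = k]) (auto simp: chain_length_def)
    moreover have "y i = (p ^^ (i - 1)) (p l)" using that unfolding y_def
      by (cases i) (auto simp: funpow_swap1)
    ultimately show "y i \<in> {2..n}" "vertex_degree E (y i) = 2" by auto
  qed
  have y0: "y 0 \<in> {2..n}" using tipsD(1)[OF l] by (simp add: y_def)
  have yS: "y (Suc i) = p (y i)" for i by (simp add: y_def)
  have nb: "nbrs E (y (Suc i)) = {y i, y (Suc (Suc i))}" if "Suc i \<le> k" for i
  proof -
    have yi: "y i \<in> {2..n}" using y(1)[of i] y0 that by (cases i) auto
    have s: "y (Suc i) \<in> {2..n}" "vertex_degree E (y (Suc i)) = 2" using y that by auto
    have "{y i, y (Suc (Suc i))} \<subseteq> nbrs E (y (Suc i))"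
      using yi s yS[of i] yS[of "Suc i"] by (auto simp: nbrs_eq)
    moreover have "y i \<noteq> y (Suc (Suc i))" using parent[OF yi] parent[OF s(1)] yS[of i] yS[of "Suc i"] by auto
    ultimately show ?thesis using s(2) card_seteq[of "nbrs E (y (Suc i))" "{y i, y (Suc (Suc i))}"]
      by (simp add: vertex_degree_def)
  qed
  define s where "s = k div 2"
  have walk: "(y s, x) \<in> adj E ^^ r \<Longrightarrow> r \<le> s \<Longrightarrow> s + r \<le> Suc k \<Longrightarrow> \<exists>j. x = y j \<and> s - r \<le> j \<and> j \<le> s + r" for r x
  proof (induction r arbitrary: x)
    case (Suc r)
    then obtain z where z: "(y s, z) \<in> adj E ^^ r" "{z, x} \<in> E" by auto
    then obtain j where j: "z = y j" "s - r \<le> j" "j \<le> s + r" using Suc by auto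
    then obtain i where i: "j = Suc i" "Suc i \<le> k" using Suc.prems by (cases j) auto
    have "x \<in> nbrs E (y (Suc i))" using z j i by (simp add: nbrs_def)
    then have "x = y i \<or> x = y (Suc (Suc i))" using nb[OF i(2)] by simp
    then show ?case using i j Suc.prems by (elim disjE) (rule exI[of _ i], force, rule exI[of _ "Suc (Suc i)"], force)
  qed (intro exI[of _ s], simp)
  show ?thesis
  proof (cases "s = 0")
    case False
    then have "y s \<in> {2..n}" using y(1)[of s] by (auto simp: s_def)
    then have ys: "y s \<in> {1..n}" by auto
    have "s \<le> leaf_dist n E (y s)"
    proof (rule ccontr)
      assume "\<not> ?thesis"
      moreover obtain l' where l': "l' \<in> leaves n E" "leaf_dist n E (y s) = graph_dist E (y s) l'"
        using leaf_dist_attained by blast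
      ultimately have r: "graph_dist E (y s) l' < s" by simp
      have "(y s, l') \<in> adj E ^^ graph_dist E (y s) l'"
        using graph_dist_walk[OF ys] l' by (auto simp: leaves_def)
      moreover have sk: "s + graph_dist E (y s) l' \<le> k" using r unfolding s_def by linarith
      ultimately obtain j where "l' = y j" "s - graph_dist E (y s) l' \<le> j" "j \<le> s + graph_dist E (y s) l'"
        using walk[of l' "graph_dist E (y s) l'"] r by auto
      then have "vertex_degree E l' = 2" using y(2)[of j] r sk by auto
      then show False using l'(1) by (simp add: leaves_def)
    qed
    also have "\<dots> \<le> max_leaf_dist n E" unfolding max_leaf_dist_eq using ys by (intro Max_ge) auto
    finally show ?thesis by (simp add: s_def)
  qed (simp add: s_def)
qed

end

section \<open>Many chains compete: the lower bound\<close>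

text \<open>A lower bound for the chance that a chain of length \<open>j\<close> at time \<open>t\<close> has length \<open>k\<close> at time \<open>N\<close>. Among
  the \<open>N - t\<close> remaining steps, \<open>k - j\<close> are chosen at which the chain is to be extended, each with
  probability at least \<open>1 / (4 N)\<close>, and every step is charged the factor \<open>1 - 10 k / N\<close> for the risk
  of damage. Length \<open>0\<close> has weight \<open>0\<close> because the birth of chains is accounted for by \<open>leaf_rate\<close>. Both constants leave room for the losses in \<open>chain_potential_exp_step\<close>, at times
  \<open>t \<ge> N / 2\<close>.\<close>

definition chain_weight :: "nat \<Rightarrow> nat \<Rightarrow> nat \<Rightarrow> nat \<Rightarrow> real" where
  "chain_weight N k t j = (if j = 0 then 0 else
     (1 - 10 * real k / real N) ^ (N - t) * real ((N - t) choose (k - j)) * (1 / (4 * real N)) ^ (k - j))"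

lemma binomial_Suc_le: "(m choose Suc r) \<le> m * (m choose r)"
proof -
  have "(m choose Suc r) \<le> Suc r * (m choose Suc r)" by simp
  also have "\<dots> = m * ((m - 1) choose r)" by (rule binomial_absorption)
  also have "\<dots> \<le> m * (m choose r)"
  proof (rule mult_left_mono)
    show "((m - 1) choose r) \<le> (m choose r)" by (cases m; cases r) auto
  qed simp
  finally show ?thesis .
qed

context
  fixes N k :: nat
  assumes k: "1 \<le> k" and N: "20 * k \<le> N"
begin

lemma decay_factor: "0 \<le> 1 - 10 * real k / real N" "1 - 10 * real k / real N \<le> 1"
  using k N by (auto simp: field_simps)

lemma chain_weight_nonneg: "0 \<le> chain_weight N k t j"
  using decay_factor by (simp add: chain_weight_def)

lemma chain_weight_Suc_mono:
  assumes "Suc j \<le> k"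
  shows "chain_weight N k t j \<le> chain_weight N k t (Suc j)"
proof (cases "j = 0")
  case True
  then show ?thesis using chain_weight_nonneg[of t "Suc j"] by (simp add: chain_weight_def)
next
  case False
  define r where "r = k - Suc j"
  have r: "k - j = Suc r" using assms by (simp add: r_def)
  let ?M = "N - t"
  have "real (?M choose Suc r) * (1 / (4 * real N)) \<le> real (?M choose r)"
  proof -
    have "real (?M choose Suc r) \<le> real ?M * real (?M choose r)"
      using binomial_Suc_le[of ?M r] by (metis of_nat_le_iff of_nat_mult)
    also have "\<dots> \<le> (4 * real N) * real (?M choose r)" by (intro mult_right_mono) auto
    finally show ?thesis using k N by (simp add: field_simps)
  qed
  then have "real (?M choose Suc r) * (1 / (4 * real N)) * (1 / (4 * real N)) ^ r \<le> real (?M choose r) * (1 / (4 * real N)) ^ r"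
    by (intro mult_right_mono) auto
  then have "(1 - 10 * real k / real N) ^ ?M * (real (?M choose Suc r) * (1 / (4 * real N)) * (1 / (4 * real N)) ^ r)
    \<le> (1 - 10 * real k / real N) ^ ?M * (real (?M choose r) * (1 / (4 * real N)) ^ r)"
    using decay_factor by (intro mult_left_mono) auto
  then show ?thesis using False unfolding chain_weight_def r r_def[symmetric] by (simp add: mult_ac)
qed

lemma chain_weight_mono: "i \<le> j \<Longrightarrow> j \<le> k \<Longrightarrow> chain_weight N k t i \<le> chain_weight N k t j"
proof (induction j rule: dec_induct)
  case (step j)
  then show ?case using chain_weight_Suc_mono[of j t] by linarith
qed simp

lemma chain_weight_le_1: "j \<le> k \<Longrightarrow> chain_weight N k t j \<le> 1"
proof -
  assume "j \<le> k"
  then have "chain_weight N k t j \<le> chain_weight N k t k" by (intro chain_weight_mono) auto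
  also have "\<dots> \<le> 1" using k decay_factor by (simp add: chain_weight_def power_le_one)
  finally show ?thesis .
qed

text \<open>Pascal's rule for the binomial coefficient is the backward recursion over one step: either the
  step extends the chain or it does not.\<close>

lemma chain_weight_drift:
  assumes t: "N \<le> 2 * t" "t < N" and j: "1 \<le> j" "j \<le> k"
  defines "\<alpha> \<equiv> chain_weight N k (Suc t)"
  shows "chain_weight N k t j \<le> \<alpha> j + ((\<alpha> (min k (Suc j)) - \<alpha> j - \<alpha> 1) / 4 - 4 * real j * \<alpha> j) / t"
proof -
  define \<rho> q M where "\<rho> = 1 - 10 * real k / real N" and "q = 1 / (4 * real N)" and "M = N - Suc t"
  have M: "N - t = Suc M" using t by (simp add: M_def)
  have t0: "t > 0" using t k N by auto
  have nn: "0 \<le> \<alpha> i" for i unfolding \<alpha>_def by (rule chain_weight_nonneg)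
  have \<rho>: "0 \<le> \<rho>" "\<rho> \<le> 1" using decay_factor by (auto simp: \<rho>_def)
  have \<alpha>: "\<alpha> i = \<rho> ^ M * real (M choose (k - i)) * q ^ (k - i)" if "i \<noteq> 0" for i
    using that by (simp add: \<alpha>_def chain_weight_def \<rho>_def q_def M_def)
  have \<alpha>1: "\<alpha> 1 \<le> \<alpha> j" unfolding \<alpha>_def using j by (intro chain_weight_mono) auto
  have main: "\<rho> * \<alpha> j \<le> \<alpha> j + (- \<alpha> j / 4 - \<alpha> 1 / 4 - 4 * real j * \<alpha> j) / t"
  proof -
    have "real N \<le> 2 * real t" using t by linarith
    then have "5 * real k / t \<le> 10 * real k / N" using t0 k N by (simp add: field_simps)
    then have "\<rho> \<le> 1 - 5 * real k / t" by (simp add: \<rho>_def)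
    then have "\<rho> * \<alpha> j \<le> (1 - 5 * real k / t) * \<alpha> j" using nn by (intro mult_right_mono)
    also have "\<dots> = \<alpha> j - (5 * real k * \<alpha> j) / t" by (simp add: algebra_simps)
    also have "\<dots> \<le> \<alpha> j - (\<alpha> j / 4 + \<alpha> 1 / 4 + 4 * real j * \<alpha> j) / t"
    proof -
      have "\<alpha> j / 4 + \<alpha> 1 / 4 + 4 * real j * \<alpha> j \<le> \<alpha> j * (1 + 4 * real j)" using \<alpha>1 nn[of j] by (simp add: algebra_simps)
      also have "\<dots> \<le> \<alpha> j * (5 * real k)" using j nn[of j] by (intro mult_left_mono) auto
      finally show ?thesis using t0 by (intro diff_left_mono divide_right_mono) (auto simp: mult_ac)
    qed
    finally show ?thesis by (simp add: diff_divide_distrib add_divide_distrib)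
  qed
  show ?thesis
  proof (cases "j = k")
    case True
    have "chain_weight N k t j = \<rho> * \<alpha> j"
      using True k \<alpha>[of k] unfolding chain_weight_def M by (simp add: \<rho>_def)
    also note main
    also have "\<alpha> j + (- \<alpha> j / 4 - \<alpha> 1 / 4 - 4 * real j * \<alpha> j) / t
       \<le> \<alpha> j + ((\<alpha> (min k (Suc j)) - \<alpha> j - \<alpha> 1) / 4 - 4 * real j * \<alpha> j) / t"
      using nn by (intro add_left_mono divide_right_mono) (auto simp: diff_divide_distrib)
    finally show ?thesis .
  next
    case False
    define r where "r = k - Suc j"
    have r: "k - j = Suc r" using False j by (simp add: r_def)
    have jk: "min k (Suc j) = Suc j" using False j by simp
    have "chain_weight N k t j = \<rho> * \<alpha> j + \<rho> * (q * \<alpha> (Suc j))"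
      using j \<alpha>[of j] \<alpha>[of "Suc j"] unfolding chain_weight_def M r r_def[symmetric] \<rho>_def[symmetric] q_def[symmetric]
      by (simp add: algebra_simps)
    also have "\<rho> * (q * \<alpha> (Suc j)) \<le> \<alpha> (Suc j) / 4 / t"
    proof -
      have "q \<le> 1 / (4 * real t)" unfolding q_def using t t0 by (intro divide_left_mono) auto
      then have "q * \<alpha> (Suc j) \<le> 1 / (4 * real t) * \<alpha> (Suc j)" using nn by (intro mult_right_mono)
      moreover have "\<rho> * (q * \<alpha> (Suc j)) \<le> 1 * (q * \<alpha> (Suc j))"
        using \<rho> nn by (intro mult_right_mono) (auto simp: q_def)
      ultimately show ?thesis by simp
    qed
    also have "\<rho> * \<alpha> j + \<alpha> (Suc j) / 4 / t \<le> (\<alpha> j + (- \<alpha> j / 4 - \<alpha> 1 / 4 - 4 * real j * \<alpha> j) / t) + \<alpha> (Suc j) / 4 / t"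
      using main by simp
    also have "\<dots> = \<alpha> j + ((\<alpha> (min k (Suc j)) - \<alpha> j - \<alpha> 1) / 4 - 4 * real j * \<alpha> j) / t"
      unfolding jk by (simp add: diff_divide_distrib add_divide_distrib)
    finally show ?thesis by simp
  qed
qed

definition chain_source :: "real \<Rightarrow> nat \<Rightarrow> real" where
  "chain_source h t = (\<Sum>s\<in>{t..<N}. chain_weight N k (Suc s) 1 * (h - 1) / (2 * s))"

text \<open>The source bounds the expected contribution of the chains still to be born from below, provided that the leaf
  rate has already reached \<open>h\<close>. As the leaf rate never decreases, the indicator can only switch on,
  which lowers the functional.\<close>

definition chain_functional :: "real \<Rightarrow> nat \<Rightarrow> nat set set \<Rightarrow> real" where
  "chain_functional h t E = exp (- (chain_potential (chain_weight N k t) k t E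
     + (if h \<le> leaf_rate t E then chain_source h t else 0)) / 2)"

lemma chain_source_nonneg: "1 \<le> h \<Longrightarrow> 0 \<le> chain_source h t"
  unfolding chain_source_def using chain_weight_nonneg by (intro sum_nonneg) auto

lemma chain_functional_step:
  assumes E: "rec_tree t E p" and h: "1 \<le> h" and t: "3 \<le> t" "N \<le> 2 * t" "t < N"
  shows "friend_avg t E (\<lambda>v w. chain_functional h (Suc t) (insert {w, Suc t} E)) \<le> chain_functional h t E"
proof -
  interpret rec_tree t E p by fact
  let ?\<alpha> = "chain_weight N k (Suc t)" and ?\<beta> = "chain_weight N k t"
  let ?\<Phi> = "\<lambda>w. chain_potential ?\<alpha> k (Suc t) (insert {w, Suc t} E)"
  define b where "b = (if h \<le> leaf_rate t E then chain_source h (Suc t) else 0)"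
  have "friend_avg t E (\<lambda>v w. chain_functional h (Suc t) (insert {w, Suc t} E)) \<le>
    friend_avg t E (\<lambda>v w. exp (- b / 2) * exp (- ?\<Phi> w / 2))"
  proof (rule friend_avg_mono)
    fix v w assume "w \<in> nbrs E v"
    then have w: "w \<in> {1..t}" using nbrs_subset by blast
    have "leaf_rate t E \<le> leaf_rate (Suc t) (insert {w, Suc t} E)"
      using leaf_rate_attach[OF t(1) w] rate_gain_bounds[OF t(1) w] by linarith
    then have "b \<le> (if h \<le> leaf_rate (Suc t) (insert {w, Suc t} E) then chain_source h (Suc t) else 0)"
      using chain_source_nonneg[OF h] by (auto simp: b_def)
    then show "chain_functional h (Suc t) (insert {w, Suc t} E) \<le> exp (- b / 2) * exp (- ?\<Phi> w / 2)"
      unfolding chain_functional_def by (simp flip: exp_add add: add_divide_distrib)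
  qed
  also have "\<dots> = exp (- b / 2) * friend_avg t E (\<lambda>v w. exp (- ?\<Phi> w / 2))"
    by (rule friend_avg_cmult)
  also have "\<dots> \<le> exp (- b / 2) * exp (- (chain_potential ?\<beta> k t E + ?\<alpha> 1 * max 0 (leaf_rate t E - 1) / (2 * t)) / 2)"
  proof (rule mult_left_mono)
    have "friend_avg t E (\<lambda>v w. exp (- ?\<Phi> w / 2)) \<le> exp (- (chain_potential ?\<alpha> k t E + (\<Sum>l\<in>tips t E.
       (?\<alpha> (min k (Suc (chain_length k E l))) - ?\<alpha> (chain_length k E l)) / (2 * real (vertex_degree E (p l)))
         - 4 * real (chain_length k E l) * ?\<alpha> (chain_length k E l)) / t) / 2)"
      by (rule chain_potential_exp_step) (auto intro: chain_weight_nonneg chain_weight_le_1 chain_weight_mono)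
    also have "\<dots> \<le> exp (- (chain_potential ?\<beta> k t E + ?\<alpha> 1 * max 0 (leaf_rate t E - 1) / (2 * t)) / 2)"
    proof -
      have "chain_potential ?\<beta> k t E + ?\<alpha> 1 * max 0 (leaf_rate t E - 1) / (2 * t) \<le> chain_potential ?\<alpha> k t E + (\<Sum>l\<in>tips t E.
       (?\<alpha> (min k (Suc (chain_length k E l))) - ?\<alpha> (chain_length k E l)) / (2 * real (vertex_degree E (p l)))
         - 4 * real (chain_length k E l) * ?\<alpha> (chain_length k E l)) / t"
        using chain_weight_drift[OF t(2,3)] chain_weight_nonneg chain_weight_le_1[OF k]
        by (intro chain_potential_drift k) (auto simp: chain_weight_def[of _ _ _ 0])
      then show ?thesis by simp
    qed
    finally show "friend_avg t E (\<lambda>v w. exp (- ?\<Phi> w / 2)) \<le> \<dots>" .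
  qed simp
  also have "\<dots> = exp (- (chain_potential ?\<beta> k t E + (b + ?\<alpha> 1 * max 0 (leaf_rate t E - 1) / (2 * t))) / 2)"
    by (simp add: add_divide_distrib flip: exp_add)
  also have "\<dots> \<le> chain_functional h t E"
  proof -
    have "(if h \<le> leaf_rate t E then chain_source h t else 0) \<le> b + ?\<alpha> 1 * max 0 (leaf_rate t E - 1) / (2 * t)"
    proof (cases "h \<le> leaf_rate t E")
      case True
      have "{t..<N} = insert t {Suc t..<N}" using t by auto
      then have "chain_source h t = ?\<alpha> 1 * (h - 1) / (2 * t) + chain_source h (Suc t)"
        by (simp add: chain_source_def)
      also have "?\<alpha> 1 * (h - 1) / (2 * t) \<le> ?\<alpha> 1 * max 0 (leaf_rate t E - 1) / (2 * t)"
        using True chain_weight_nonneg by (intro divide_right_mono mult_left_mono) auto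
      finally show ?thesis using True by (simp add: b_def)
    next
      case False
      then show ?thesis using chain_weight_nonneg[of "Suc t" 1] by (simp add: b_def)
    qed
    then show ?thesis unfolding chain_functional_def by simp
  qed
  finally show ?thesis .
qed

lemma chain_functional_expectation_decreasing:
  assumes h: "1 \<le> h" and m: "3 \<le> m" "N \<le> 2 * m" and t: "m \<le> t" "t \<le> N"
  shows "measure_pmf.expectation (friend_pmf t) (chain_functional h t)
    \<le> measure_pmf.expectation (friend_pmf m) (chain_functional h m)"
  using t
proof (induction t rule: dec_induct)
  case (step t)
  have "measure_pmf.expectation (friend_pmf (Suc t)) (chain_functional h (Suc t))
    \<le> 1 * measure_pmf.expectation (friend_pmf t) (chain_functional h t) + 0"
    using chain_functional_step[OF _ h] step m by (intro friend_pmf_expectation_le) auto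
  then show ?case using step by simp
qed simp

text \<open>At time \<open>N\<close> the source is empty and only chains of full length \<open>k\<close> have positive weight, so the
  functional is \<open>1\<close> in the absence of such a chain. At time \<open>m\<close> it is at most \<open>exp (- chain_source h m / 2)\<close>
  unless the leaf rate is below \<open>h\<close>.\<close>

lemma prob_no_chain_le:
  assumes h: "1 \<le> h" and m: "3 \<le> m" "N \<le> 2 * m" "m \<le> N"
  shows "measure_pmf.prob (friend_pmf N) {E. max_leaf_dist N E < k div 2}
    \<le> measure_pmf.prob (friend_pmf m) {E. leaf_rate m E < h} + exp (- chain_source h m / 2)"
proof -
  have N2: "2 \<le> N" using k N by linarith
  have "measure_pmf.prob (friend_pmf N) {E. max_leaf_dist N E < k div 2}
    \<le> measure_pmf.expectation (friend_pmf N) (chain_functional h N) / 1"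
  proof (rule friend_pmf_Markov[OF N2])
    fix E p assume "rec_tree N E p"
    then interpret rec_tree N E p .
    assume "E \<in> {E. max_leaf_dist N E < k div 2}"
    then have no: "chain_length k E l \<noteq> k" if "l \<in> tips N E" for l
      using max_leaf_dist_ge_chain[OF that, of k] by auto
    have "chain_potential (chain_weight N k N) k N E = 0"
      unfolding chain_potential_def
    proof (intro sum.neutral ballI)
      fix l assume "l \<in> tips N E"
      then have "chain_length k E l < k" using no chain_length_le[of k l] by (simp add: order_less_le)
      then show "chain_weight N k N (chain_length k E l) = 0" by (simp add: chain_weight_def)
    qed
    then show "1 \<le> chain_functional h N E" by (simp add: chain_functional_def chain_source_def)
  qed (auto simp: chain_functional_def)
  also have "\<dots> \<le> measure_pmf.expectation (friend_pmf m) (chain_functional h m)"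
    using chain_functional_expectation_decreasing[OF h m(1,2) m(3)] by simp
  finally have le: "measure_pmf.prob (friend_pmf N) {E. max_leaf_dist N E < k div 2}
    \<le> measure_pmf.expectation (friend_pmf m) (chain_functional h m)" .
  have fin: "finite (set_pmf (friend_pmf m))" using friend_pmf_support[of m] m by simp
  have "measure_pmf.expectation (friend_pmf m) (chain_functional h m) \<le>
      measure_pmf.expectation (friend_pmf m) (\<lambda>E. indicator {E. leaf_rate m E < h} E + exp (- chain_source h m / 2))"
  proof (rule integral_mono)
    show "integrable (friend_pmf m) (chain_functional h m)"
      "integrable (friend_pmf m) (\<lambda>E. indicat_real {E. leaf_rate m E < h} E + exp (- chain_source h m / 2))"
      using fin by (auto intro: integrable_measure_pmf_finite)
    fix E
    have "0 \<le> chain_potential (chain_weight N k m) k m E"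
      unfolding chain_potential_def using chain_weight_nonneg by (intro sum_nonneg) auto
    then show "chain_functional h m E \<le> indicator {E. leaf_rate m E < h} E + exp (- chain_source h m / 2)"
      unfolding chain_functional_def using chain_source_nonneg[OF h, of m]
      by (cases "leaf_rate m E < h") (auto intro: add_increasing2)
  qed
  also have "\<dots> = measure_pmf.prob (friend_pmf m) {E. leaf_rate m E < h} + exp (- chain_source h m / 2)"
    using fin by (subst Bochner_Integration.integral_add) (auto intro: integrable_measure_pmf_finite)
  finally show ?thesis using le by linarith
qed

text \<open>With \<open>M = N - t \<ge> N / 4\<close> and \<open>r = k - 1\<close>, use \<open>(M choose r) \<ge> (M / r)^r\<close>, and
  \<open>1 - x \<ge> exp (- 2 x)\<close> for \<open>x = 10 k / N \<le> 1/2\<close>.\<close>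

lemma chain_weight_lower:
  assumes t: "N \<le> 4 * (N - t)"
  shows "exp (- (20 * real k + real k * ln (16 * real k))) \<le> chain_weight N k t 1"
proof -
  define \<rho> where "\<rho> = 1 - 10 * real k / real N"
  have N0: "real N > 0" using k N by simp
  have "exp (- (20 * real k)) \<le> \<rho> ^ N"
  proof -
    define x where "x = 10 * real k / real N"
    have x: "0 \<le> x" "x \<le> 1/2" using N N0 by (auto simp: x_def field_simps)
    have "1 \<le> (1 + 2 * x) * (1 - x)"
    proof -
      have "0 \<le> x * (1 - 2 * x)" using x by (intro mult_nonneg_nonneg) auto
      then show ?thesis by (simp add: algebra_simps)
    qed
    also have "\<dots> \<le> exp (2 * x) * (1 - x)" using x by (intro mult_right_mono exp_ge_add_one_self) auto
    finally have "exp (- (2 * x)) \<le> 1 - x" by (simp add: exp_minus field_simps)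
    then have "exp (- (2 * x)) ^ N \<le> (1 - x) ^ N" by (intro power_mono) auto
    moreover have "exp (- (2 * x)) ^ N = exp (- (20 * real k))" using N0 by (simp add: x_def flip: exp_of_nat_mult)
    ultimately show ?thesis by (simp add: x_def \<rho>_def)
  qed
  also have "\<dots> \<le> \<rho> ^ (N - t)" using decay_factor by (intro power_decreasing) (auto simp: \<rho>_def)
  finally have 1: "exp (- (20 * real k)) \<le> \<rho> ^ (N - t)" .
  define r where "r = k - 1"
  have 2: "exp (- (real k * ln (16 * real k))) \<le> real ((N - t) choose r) * (1 / (4 * real N)) ^ r"
  proof -
    have "exp (- (real k * ln (16 * real k))) = (1 / (16 * real k)) ^ k"
      using k by (simp add: exp_minus power_one_over exp_of_nat_mult inverse_eq_divide)
    also have "\<dots> \<le> (1 / (16 * real k)) ^ r" using k by (intro power_decreasing) (auto simp: r_def)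
    also have "\<dots> \<le> real ((N - t) choose r) * (1 / (4 * real N)) ^ r"
    proof (cases "r = 0")
      case False
      have "1 / (16 * real k) \<le> real (N - t) / real r * (1 / (4 * real N))"
      proof -
        have "real N * real r \<le> (4 * real (N - t)) * real k"
          using t by (intro mult_mono) (auto simp: r_def)
        then show ?thesis using False N0 k by (simp add: field_simps)
      qed
      then have "(1 / (16 * real k)) ^ r \<le> (real (N - t) / real r * (1 / (4 * real N))) ^ r"
        by (intro power_mono) auto
      also have "\<dots> = (real (N - t) / real r) ^ r * (1 / (4 * real N)) ^ r" by (rule power_mult_distrib)
      also have "\<dots> \<le> real ((N - t) choose r) * (1 / (4 * real N)) ^ r"
      proof (intro mult_right_mono binomial_ge_n_over_k_pow_k)
        show "r \<le> N - t" using t N unfolding r_def by linarith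
      qed simp
      finally show ?thesis .
    qed simp
    finally show ?thesis .
  qed
  have "exp (- (20 * real k + real k * ln (16 * real k))) = exp (- (20 * real k)) * exp (- (real k * ln (16 * real k)))"
    by (simp flip: exp_add)
  also have "\<dots> \<le> \<rho> ^ (N - t) * (real ((N - t) choose r) * (1 / (4 * real N)) ^ r)"
    using decay_factor by (intro mult_mono 1 2) (auto simp: \<rho>_def)
  finally show ?thesis by (simp add: chain_weight_def \<rho>_def r_def mult_ac)
qed

text \<open>Only births within the first \<open>N div 8\<close> steps after time \<open>N div 2\<close> are counted. At least \<open>N / 4\<close> steps
  then remain, so each of these chains has the chance computed in \<open>chain_weight_lower\<close>.\<close>

lemma chain_source_lower:
  assumes h: "1 \<le> h"
  shows "exp (- (20 * real k + real k * ln (16 * real k))) * (h - 1) / 32 \<le> chain_source h (N div 2 + 1)"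
proof -
  define m where "m = N div 2 + 1"
  define w where "w = exp (- (20 * real k + real k * ln (16 * real k)))"
  have N20: "20 \<le> N" using k N by linarith
  have "w * (h - 1) / 32 = (N / 16) * (w * (h - 1) / (2 * N))" using N20 by simp
  also have "\<dots> \<le> real (card {m..<m + N div 8}) * (w * (h - 1) / (2 * N))"
  proof (rule mult_right_mono)
    have "N \<le> 16 * (N div 8)" using N20 by linarith
    then show "real N / 16 \<le> real (card {m..<m + N div 8})" by simp
    show "0 \<le> w * (h - 1) / (2 * N)" using h by (simp add: w_def)
  qed
  also have "\<dots> = (\<Sum>s\<in>{m..<m + N div 8}. w * (h - 1) / (2 * N))" by simp
  also have "\<dots> \<le> (\<Sum>s\<in>{m..<m + N div 8}. chain_weight N k (Suc s) 1 * (h - 1) / (2 * s))"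
  proof (rule sum_mono)
    fix s assume s: "s \<in> {m..<m + N div 8}"
    then have "N \<le> 4 * (N - Suc s)" "s \<le> N" "0 < s" using N20 by (auto simp: m_def)
    then show "w * (h - 1) / (2 * N) \<le> chain_weight N k (Suc s) 1 * (h - 1) / (2 * s)"
      using h chain_weight_lower[of "Suc s"] chain_weight_nonneg[of "Suc s" 1] unfolding w_def
      by (intro frac_le mult_right_mono) auto
  qed
  also have "\<dots> \<le> chain_source h m"
    unfolding chain_source_def using h chain_weight_nonneg N20
    by (intro sum_mono2) (auto simp: m_def)
  finally show ?thesis by (simp add: w_def m_def)
qed

end

lemma max_leaf_dist_lower_tendsto:
  "(\<lambda>n. measure_pmf.prob (friend_pmf n) {E. ln (real n) / ln (ln (real n)) > 800 * real (max_leaf_dist n E)}) \<longlonglongrightarrow> 0"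
proof -
  obtain K :: real where K: "K > 0"
    "\<And>n h. 4 \<le> n \<Longrightarrow> 0 < h \<Longrightarrow> measure_pmf.prob (friend_pmf n) {E. leaf_rate n E < h} \<le> K * h * real n powr (- (1/18))"
    using prob_leaf_rate_small by blast
  \<comment> \<open>The chance of a chain is about \<open>n\<close> to the power \<open>- 1/200\<close>, which the birth rate \<open>h\<close> outweighs.\<close>
  define \<kappa> where "\<kappa> n = ln (real n) / ln (ln (real n)) / 200" for n :: nat
  define h where "h n = (real n / 2) powr (1/36)" for n :: nat
  define b where "b n = exp (- (20 * \<kappa> n + \<kappa> n * ln (16 * \<kappa> n))) * (h n - 1) / 32" for n :: nat
  have b: "filterlim b at_top at_top" unfolding b_def \<kappa>_def h_def by real_asymp
  have lim1: "(\<lambda>n. K * (real n / 2) powr (- (1/36))) \<longlonglongrightarrow> 0" by real_asymp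
  have lim2: "(\<lambda>n. exp (- b n / 2)) \<longlonglongrightarrow> 0"
  proof (rule filterlim_compose[OF _ b])
    show "((\<lambda>x::real. exp (- x / 2)) \<longlongrightarrow> 0) at_top" by real_asymp
  qed
  have lim: "(\<lambda>n. K * (real n / 2) powr (- (1/36)) + exp (- b n / 2)) \<longlonglongrightarrow> 0"
    using tendsto_add[OF lim1 lim2] by simp
  have ev: "\<forall>\<^sub>F n in sequentially. \<kappa> n \<ge> 4" "\<forall>\<^sub>F n in sequentially. 20 * \<kappa> n \<le> real n" "\<forall>\<^sub>F n in sequentially. h n \<ge> 1"
    unfolding \<kappa>_def h_def by real_asymp+
  have bound: "\<forall>\<^sub>F n in sequentially. measure_pmf.prob (friend_pmf n)
      {E. ln (real n) / ln (ln (real n)) > 800 * real (max_leaf_dist n E)} \<le> K * (real n / 2) powr (- (1/36)) + exp (- b n / 2)"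
    using ev
  proof eventually_elim
    case (elim n)
    define k where "k = nat \<lfloor>\<kappa> n\<rfloor>"
    have k\<kappa>: "real k \<le> \<kappa> n" "\<kappa> n < real k + 1" using elim(1) unfolding k_def by linarith+
    have k: "1 \<le> k" using k\<kappa> elim(1) by linarith
    have N: "20 * k \<le> n" using k\<kappa> elim(2) by linarith
    define m where "m = n div 2 + 1"
    have "20 \<le> n" using k N by linarith
    then have "3 \<le> m \<and> 4 \<le> m \<and> n \<le> 2 * m \<and> m \<le> n" unfolding m_def by presburger
    then have m: "3 \<le> m" "4 \<le> m" "n \<le> 2 * m" "m \<le> n" by auto
    then have m2: "real n / 2 \<le> real m" by linarith
    have "measure_pmf.prob (friend_pmf n) {E. ln (real n) / ln (ln (real n)) > 800 * real (max_leaf_dist n E)}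
      \<le> measure_pmf.prob (friend_pmf n) {E. max_leaf_dist n E < k div 2}"
    proof (intro measure_pmf.finite_measure_mono subsetI)
      fix E assume "E \<in> {E. ln (real n) / ln (ln (real n)) > 800 * real (max_leaf_dist n E)}"
      then have "800 * real (max_leaf_dist n E) < 200 * \<kappa> n" by (simp add: \<kappa>_def)
      then have "4 * max_leaf_dist n E \<le> k" "4 \<le> k" using k\<kappa> elim(1) by linarith+
      then have "max_leaf_dist n E < k div 2" by linarith
      then show "E \<in> {E. max_leaf_dist n E < k div 2}" by simp
    qed simp
    also have "\<dots> \<le> measure_pmf.prob (friend_pmf m) {E. leaf_rate m E < h n} + exp (- chain_source n k (h n) m / 2)"
      by (rule prob_no_chain_le[OF k N elim(3) m(1,3,4)])
    also have "\<dots> \<le> K * (real n / 2) powr (- (1/36)) + exp (- b n / 2)"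
    proof (rule add_mono)
      have n0: "real n > 0" using k N by simp
      have "measure_pmf.prob (friend_pmf m) {E. leaf_rate m E < h n} \<le> K * h n * real m powr (- (1/18))"
        using K(2)[OF m(2)] elim(3) by simp
      also have "\<dots> \<le> K * h n * (real n / 2) powr (- (1/18))"
        using K(1) elim(3) m2 n0 by (intro mult_left_mono powr_mono2') auto
      also have "\<dots> = K * (real n / 2) powr (- (1/36))"
        using n0 by (simp add: h_def flip: powr_add)
      finally show "measure_pmf.prob (friend_pmf m) {E. leaf_rate m E < h n} \<le> K * (real n / 2) powr (- (1/36))" .
      have "real k * ln (16 * real k) \<le> \<kappa> n * ln (16 * \<kappa> n)"
        using k\<kappa> k elim(1) by (intro mult_mono ln_mono) auto
      then have "b n \<le> exp (- (20 * real k + real k * ln (16 * real k))) * (h n - 1) / 32"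
        unfolding b_def using k\<kappa> elim(3) by (intro divide_right_mono mult_right_mono) auto
      also have "\<dots> \<le> chain_source n k (h n) m"
        unfolding m_def by (rule chain_source_lower[OF k N elim(3)])
      finally show "exp (- chain_source n k (h n) m / 2) \<le> exp (- b n / 2)" by simp
    qed
    finally show ?case .
  qed
  show ?thesis
    by (rule tendsto_sandwich[OF _ bound tendsto_const lim]) simp
qed

section \<open>The order of the maximal distance\<close>

theorem theorem4p3:
  fixes M :: "'a measure"
    and V W :: "nat \<Rightarrow> 'a \<Rightarrow> nat"
    and T :: "nat \<Rightarrow> 'a \<Rightarrow> nat set set"
  assumes "random_friend_tree M V W T"
  shows "Theta_p M (\<lambda>n \<omega>. real (max_leaf_dist n (T n \<omega>)))
           (\<lambda>n \<omega>. ln (real n) / ln (ln (real n)))"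
proof -
  interpret random_friend_tree M V W T by fact
  have "\<exists>N>0. \<exists>K>0. \<forall>n\<ge>N. \<P>(\<omega> in M. Q K n (T n \<omega>)) < \<epsilon>"
    if "0 < c" "(\<lambda>n. measure_pmf.prob (friend_pmf n) {E. Q c n E}) \<longlonglongrightarrow> 0" "0 < \<epsilon>"
    for Q :: "real \<Rightarrow> nat \<Rightarrow> nat set set \<Rightarrow> bool" and c \<epsilon> :: real
  proof -
    have "\<forall>\<^sub>F n in sequentially. measure_pmf.prob (friend_pmf n) {E. Q c n E} < \<epsilon>"
      using order_tendstoD(2)[OF that(2,3)] .
    then obtain N where N: "\<And>n. n \<ge> N \<Longrightarrow> measure_pmf.prob (friend_pmf n) {E. Q c n E} < \<epsilon>"
      by (auto simp: eventually_sequentially)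
    have "\<P>(\<omega> in M. Q c n (T n \<omega>)) < \<epsilon>" if "n \<ge> max 2 N" for n
      using prob_T[of n "{E. Q c n E}"] N[of n] that by simp
    then show ?thesis using \<open>0 < c\<close> by (intro exI[of _ "max 2 N"] exI[of _ c] conjI) auto
  qed
  from this[of 8 "\<lambda>K n E. real (max_leaf_dist n E) > K * (ln (real n) / ln (ln (real n)))", OF _ max_leaf_dist_upper_tendsto]
    this[of 800 "\<lambda>K n E. ln (real n) / ln (ln (real n)) > K * real (max_leaf_dist n E)", OF _ max_leaf_dist_lower_tendsto]
  show ?thesis unfolding Theta_p_def Omega_p_def O_p_def by simp
qed

end
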